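(* There exist absolute constants $c_1>0$, $c_0,c_2\ge 1$, $\tilde C_1\ge 15$, $\tilde C_2\ge 1$ such that the following holds. Suppose $G_{t'}\sim\mathcal G(n,p(t'))$ for all $t'\in\mathcal T$, so that for a given $t\in[0,1]$ one has $G_\delta(t)\sim\mathcal G(n,p_\delta(t))$. Choose $d_\delta(t)=3np_\delta(t)$, and let $\delta\in[\tfrac12,T]$ be such that $n\ge c_1\log n$, $np_\delta(t)\ge c_0\log n$ and $p_{\delta,sum}(t)\ge c_2\log n$. If $$2\tilde C_1\sqrt{\frac{\log n}{L\,n\,p_\delta(t)\,p_{\delta,sum}(t)}}+16\,\frac{M\delta n}{T}\le\frac{1}{96\,b^{7/2}(t)},$$ then with probability at least $1-O(n^{-10})$, $$\frac{\|\hat\pi(t)-\pi^*(t)\|_2}{\|\pi^*(t)\|_2}\le 1536\,\frac{M\delta n\,b^{7/2}(t)}{T}+64\,\tilde C_2\,b^{9/2}(t)\sqrt{\frac{3}{L\,n\,p_\delta(t)\,p_{\delta,sum}(t)}}.$$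
   Context: Dynamic BTL model. Let $n\ge 2$, $T\ge 1$, $L\ge 1$ be integers, $[n]=\{1,\dots,n\}$. For each $t\in[0,1]$ let $w_t^*\in\mathbb R^n$ have strictly positive entries $w^*_{t,i}$, and for $i\ne j$ put $y^*_{ij}(t)=\frac{w^*_{t,j}}{w^*_{t,i}+w^*_{t,j}}$. Smoothness assumption: there is $M\ge0$ with $|y^*_{ij}(t)-y^*_{ij}(t')|\le M|t-t'|$ for all $t,t'\in[0,1]$ and $i\ne j$. Grid: $\mathcal T=\{i/T: i=0,\dots,T\}$. For each $t'\in\mathcal T$ there is an undirected comparison graph $G_{t'}=([n],\mathcal E_{t'})$. Given the graphs, for each $t'\in\mathcal T$, $\{i,j\}\in\mathcal E_{t'}$ and $l\in\{1,\dots,L\}$ one observes $y^{(l)}_{ij}(t')\in\{0,1\}$ with $\mathbb P(y^{(l)}_{ij}(t')=1)=y^*_{ij}(t')$ (the value 1 means $j$ beats $i$), with $y^{(l)}_{ji}(t')=1-y^{(l)}_{ij}(t')$, all outcomes being independent across unordered pairs, times $t'$ and indices $l$. Put $y_{ij}(t')=\frac1L\sum_{l=1}^L y^{(l)}_{ij}(t')$. Neighborhood and union graph. For $t\in[0,1]$, $\delta\in[\frac12,T]$: $\mathcal N_\delta(t)=\{t'\in\mathcal T: |t-t'|\le \delta/T\}$; $\mathcal N_{ij,\delta}(t)=\{t'\in\mathcal N_\delta(t): \{i,j\}\in\mathcal E_{t'}\}$; $G_\delta(t)=([n],\mathcal E_\delta(t))$ with $\mathcal E_\delta(t)=\bigcup_{t'\in\mathcal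 N_\delta(t)}\mathcal E_{t'}$. Erdős–Rényi setting. $\mathcal G(n,p)$ is the Erdős–Rényi random graph in which each pair is an edge independently with probability $p$; the graphs $G_{t'}\sim\mathcal G(n,p(t'))$, $t'\in\mathcal T$, are mutually independent, with $p(t')\in[0,1]$. Put $p_\delta(t)=1-\prod_{t'\in\mathcal N_\delta(t)}(1-p(t'))$ and $p_{\delta,sum}(t)=\sum_{t'\in\mathcal N_\delta(t)}p(t')$. Estimator. With normalization $d_\delta(t)$, define $\hat P(t)\in\mathbb R^{n\times n}$ by $\hat P_{ij}(t)=\frac{1}{d_\delta(t)|\mathcal N_{ij,\delta}(t)|}\sum_{t'\in\mathcal N_{ij,\delta}(t)}y_{ij}(t')$ if $\{i,j\}\in\mathcal E_\delta(t)$, $\hat P_{ij}(t)=0$ for other $i\neq j$, and $\hat P_{ii}(t)=1-\sum_{k\ne i}\hat P_{ik}(t)$. $\hat\pi(t)$ is the stationary distribution (leading left eigenvector, normalized to be a probability vector) of $\hat P(t)$. The target is $\pi^*(t)=w_t^*/\sum_{i=1}^n w^*_{t,i}$, and $b(t)=\max_{i,j\in[n]}w^*_{t,i}/w^*_{t,j}$. Convention: $O(\cdot)$ hides an absolute constant. Probability is over both graphs and outcomes. *)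

theory Defs
  imports "HOL-Probability.Probability"
begin

definition y_star :: "(real \<Rightarrow> nat \<Rightarrow> real) \<Rightarrow> nat \<Rightarrow> nat \<Rightarrow> real \<Rightarrow> real" where
  "y_star w i j t = w t j / (w t i + w t j)"

definition pi_star :: "nat \<Rightarrow> (real \<Rightarrow> nat \<Rightarrow> real) \<Rightarrow> real \<Rightarrow> nat \<Rightarrow> real" where
  "pi_star n w t i = w t i / (\<Sum>k\<in>{1..n}. w t k)"

definition b_ratio :: "nat \<Rightarrow> (real \<Rightarrow> nat \<Rightarrow> real) \<Rightarrow> real \<Rightarrow> real" where
  "b_ratio n w t = Max {w t i / w t j | i j. i \<in> {1..n} \<and> j \<in> {1..n}}"

definition grid :: "nat \<Rightarrow> real set" where
  "grid T = (\<lambda>i. real i / real T) ` {0..T}"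

definition nbhd :: "nat \<Rightarrow> real \<Rightarrow> real \<Rightarrow> real set" where
  "nbhd T \<delta> t = {t' \<in> grid T. \<bar>t - t'\<bar> \<le> \<delta> / real T}"

definition p_union :: "nat \<Rightarrow> (real \<Rightarrow> real) \<Rightarrow> real \<Rightarrow> real \<Rightarrow> real" where
  "p_union T p \<delta> t = 1 - (\<Prod>t'\<in>nbhd T \<delta> t. 1 - p t')"

definition p_sum :: "nat \<Rightarrow> (real \<Rightarrow> real) \<Rightarrow> real \<Rightarrow> real \<Rightarrow> real" where
  "p_sum T p \<delta> t = (\<Sum>t'\<in>nbhd T \<delta> t. p t')"

text \<open>A graph on the vertex set \<open>{1..n}\<close> is represented by its set of edges \<open>{i, j}\<close>.\<close>

definition vertex_pairs :: "nat \<Rightarrow> nat set set" where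
  "vertex_pairs n = {{i, j} | i j. i \<in> {1..n} \<and> j \<in> {1..n} \<and> i \<noteq> j}"

definition erdos_renyi :: "nat \<Rightarrow> real \<Rightarrow> nat set set pmf" where
  "erdos_renyi n q =
     map_pmf (\<lambda>f. {e \<in> vertex_pairs n. f e})
       (Pi_pmf (vertex_pairs n) False (\<lambda>_. bernoulli_pmf q))"

definition graphs_pmf :: "nat \<Rightarrow> nat \<Rightarrow> (real \<Rightarrow> real) \<Rightarrow> (real \<Rightarrow> nat set set) pmf" where
  "graphs_pmf n T p = Pi_pmf (grid T) {} (\<lambda>t'. erdos_renyi n (p t'))"

text \<open>
  One independent coin \<open>(t', i, j, l)\<close> is tossed for each unordered pair, oriented by
  \<open>i < j\<close>; the reversed outcome is its complement, see \<open>outcome\<close> below.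
\<close>

definition observations ::
    "nat \<Rightarrow> nat \<Rightarrow> nat \<Rightarrow> (real \<Rightarrow> nat set set) \<Rightarrow> (real \<times> nat \<times> nat \<times> nat) set" where
  "observations n T L G =
     {(t', i, j, l). t' \<in> grid T \<and> i \<in> {1..n} \<and> j \<in> {1..n} \<and> i < j \<and>
        {i, j} \<in> G t' \<and> l \<in> {1..L}}"

definition outcomes_pmf ::
    "nat \<Rightarrow> nat \<Rightarrow> nat \<Rightarrow> (real \<Rightarrow> nat \<Rightarrow> real) \<Rightarrow> (real \<Rightarrow> nat set set) \<Rightarrow>
     (real \<times> nat \<times> nat \<times> nat \<Rightarrow> bool) pmf" where
  "outcomes_pmf n T L w G =
     Pi_pmf (observations n T L G) False (\<lambda>(t', i, j, l). bernoulli_pmf (y_star w i j t'))"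

text \<open>The joint law of the graphs and, conditionally on the graphs, of the outcomes.\<close>

definition dynamic_btl_pmf ::
    "nat \<Rightarrow> nat \<Rightarrow> nat \<Rightarrow> (real \<Rightarrow> nat \<Rightarrow> real) \<Rightarrow> (real \<Rightarrow> real) \<Rightarrow>
     ((real \<Rightarrow> nat set set) \<times> (real \<times> nat \<times> nat \<times> nat \<Rightarrow> bool)) pmf" where
  "dynamic_btl_pmf n T L w p =
     bind_pmf (graphs_pmf n T p) (\<lambda>G. map_pmf (Pair G) (outcomes_pmf n T L w G))"

definition outcome ::
    "(real \<times> nat \<times> nat \<times> nat \<Rightarrow> bool) \<Rightarrow> nat \<Rightarrow> nat \<Rightarrow> nat \<Rightarrow> real \<Rightarrow> real" where
  "outcome z l i j t' =
     (if i < j then of_bool (z (t', i, j, l)) else 1 - of_bool (z (t', j, i, l)))"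

definition y_bar ::
    "nat \<Rightarrow> (real \<times> nat \<times> nat \<times> nat \<Rightarrow> bool) \<Rightarrow> nat \<Rightarrow> nat \<Rightarrow> real \<Rightarrow> real" where
  "y_bar L z i j t' = (\<Sum>l\<in>{1..L}. outcome z l i j t') / real L"

definition edge_nbhd ::
    "nat \<Rightarrow> (real \<Rightarrow> nat set set) \<Rightarrow> real \<Rightarrow> real \<Rightarrow> nat \<Rightarrow> nat \<Rightarrow> real set" where
  "edge_nbhd T G \<delta> t i j = {t' \<in> nbhd T \<delta> t. {i, j} \<in> G t'}"

definition union_edges ::
    "nat \<Rightarrow> (real \<Rightarrow> nat set set) \<Rightarrow> real \<Rightarrow> real \<Rightarrow> nat set set" where
  "union_edges T G \<delta> t = (\<Union>t'\<in>nbhd T \<delta> t. G t')"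

definition P_hat_off ::
    "nat \<Rightarrow> nat \<Rightarrow> real \<Rightarrow> real \<Rightarrow> real \<Rightarrow> (real \<Rightarrow> nat set set) \<Rightarrow>
     (real \<times> nat \<times> nat \<times> nat \<Rightarrow> bool) \<Rightarrow> nat \<Rightarrow> nat \<Rightarrow> real" where
  "P_hat_off T L d \<delta> t G z i j =
     (if {i, j} \<in> union_edges T G \<delta> t
      then (\<Sum>t'\<in>edge_nbhd T G \<delta> t i j. y_bar L z i j t')
             / (d * real (card (edge_nbhd T G \<delta> t i j)))
      else 0)"

definition P_hat ::
    "nat \<Rightarrow> nat \<Rightarrow> nat \<Rightarrow> real \<Rightarrow> real \<Rightarrow> real \<Rightarrow> (real \<Rightarrow> nat set set) \<Rightarrow>
     (real \<times> nat \<times> nat \<times> nat \<Rightarrow> bool) \<Rightarrow> nat \<Rightarrow> nat \<Rightarrow> real" where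
  "P_hat n T L d \<delta> t G z i j =
     (if i = j then 1 - (\<Sum>k\<in>{1..n} - {i}. P_hat_off T L d \<delta> t G z i k)
      else P_hat_off T L d \<delta> t G z i j)"

definition stochastic_matrix :: "nat \<Rightarrow> (nat \<Rightarrow> nat \<Rightarrow> real) \<Rightarrow> bool" where
  "stochastic_matrix n P \<longleftrightarrow>
     (\<forall>i\<in>{1..n}. \<forall>j\<in>{1..n}. 0 \<le> P i j) \<and> (\<forall>i\<in>{1..n}. (\<Sum>j\<in>{1..n}. P i j) = 1)"

text \<open>
  Stationary distributions are considered for stochastic matrices only; there the spectral
  radius is 1, so that they are exactly the leading left eigenvectors that are probability
  vectors. Distributions vanish outside \<open>{1..n}\<close>, so that uniqueness is meaningful
  for functions on \<open>nat\<close>.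
\<close>

definition stationary_distribution ::
    "nat \<Rightarrow> (nat \<Rightarrow> nat \<Rightarrow> real) \<Rightarrow> (nat \<Rightarrow> real) \<Rightarrow> bool" where
  "stationary_distribution n P \<pi> \<longleftrightarrow>
     stochastic_matrix n P \<and>
     (\<forall>i\<in>{1..n}. 0 \<le> \<pi> i) \<and> (\<Sum>i\<in>{1..n}. \<pi> i) = 1 \<and> (\<forall>i. i \<notin> {1..n} \<longrightarrow> \<pi> i = 0) \<and>
     (\<forall>j\<in>{1..n}. (\<Sum>i\<in>{1..n}. \<pi> i * P i j) = \<pi> j)"

text \<open>
  Meaningful only when the stationary distribution exists and is unique, which has to be
  asserted separately.
\<close>

definition pi_hat ::
    "nat \<Rightarrow> nat \<Rightarrow> nat \<Rightarrow> real \<Rightarrow> real \<Rightarrow> real \<Rightarrow> (real \<Rightarrow> nat set set) \<Rightarrow>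
     (real \<times> nat \<times> nat \<times> nat \<Rightarrow> bool) \<Rightarrow> nat \<Rightarrow> real" where
  "pi_hat n T L d \<delta> t G z = (THE \<pi>. stationary_distribution n (P_hat n T L d \<delta> t G z) \<pi>)"

end

theory Submission
  imports Defs "Jordan_Normal_Form.Determinant"
begin

text \<open>
  Since \<open>p_sum \<ge> c\<^sub>2 ln n\<close>, with high probability every pair is compared at least \<open>p_sum / 2\<close> times in the
  neighborhood; in particular the union graph is complete, so no spectral gap of a random graph is
  needed. For the true chain, reversible with respect to \<open>\<pi>\<close>, the Dirichlet form with resistances
  \<open>1/\<pi>\<^sub>i + 1/\<pi>\<^sub>j\<close> dominates the variance up to a factor of order \<open>b\<close>.

  The noise matrix is antisymmetric, and the hypothesis is stronger than necessary by powers of \<open>b\<close>. A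
  crude bound on its norm therefore suffices: Schur's test for its Gram matrix, whose entries are controlled by
  Hoeffding's inequality conditionally on one row, gives \<open>n\<^sup>3\<^sup>/\<^sup>4\<close> up to logarithms. Hence the perturbed
  Dirichlet form is still coercive on vectors of sum \<open>0\<close>, which yields uniqueness of the stationary
  distribution and reduces the error to the norm of \<open>\<pi>\<close> times the perturbation. The logarithm is
  avoided in that norm by linearizing the square with independent Gaussian multipliers, which
  bounds its exponential moment.
\<close>

section \<open>Stationary distributions and their perturbation\<close>

text \<open>Write \<open>r = sqrt b\<close> and \<open>x = ln n / (L * (S / 2))\<close>, where
  \<open>S\<close> is the value of \<open>p_sum\<close>; with high probability the noise entries are
  of order at most \<open>sqrt x\<close>. Coercivity leaves room of order \<open>n / r^2\<close>,
  while the Gram bound costs \<open>r * sqrt (x * n * sqrt n)\<close>, so the requirement is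
  \<open>x * r^6 = O(sqrt n)\<close>. The smallness hypothesis supplies
  \<open>x * r^14 = O(n)\<close>, and the lower bound on \<open>S\<close> supplies
  \<open>x = O(1)\<close>. As r \<ge> 1, the product of the two dominates the square of the
  requirement; this is why a crude norm bound is affordable.

  The rate itself cannot come from tail bounds row by row: a union bound over the rows would put
  \<open>ln n\<close> under the root. Nor are the rows independent, because antisymmetry makes rows
  \<open>i\<close> and \<open>j\<close> share an entry. An exponential moment of the sum of squares
  asks only for the joint moment generating function of linear combinations of the row sums, and
  there the two occurrences of a shared entry can be merged into one term per unordered
  pair.\<close>

lemma markov_fixed_vector:
  fixes P :: "nat \<Rightarrow> nat \<Rightarrow> real"
  assumes "\<And>i. i \<in> {1..n} \<Longrightarrow> (\<Sum>j\<in>{1..n}. P i j) = 1" and "n > 0"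
  shows "\<exists>v. (\<exists>i\<in>{1..n}. v i \<noteq> 0) \<and> (\<forall>j\<in>{1..n}. (\<Sum>i\<in>{1..n}. v i * P i j) = v j)"
proof -
  \<comment> \<open>This is \<open>I - P\<close> with indices shifted to start at 0. Its rows sum to
    0, so it is singular; so is its transpose, whose kernel consists of the left fixed vectors of
    \<open>P\<close>.\<close>
  define A where "A = mat n n (\<lambda>(i, j). (if i = j then 1 else 0) - P (Suc i) (Suc j))"
  have A: "A \<in> carrier_mat n n" by (simp add: A_def)
  have shift: "(\<Sum>i = 0..<n. f (Suc i)) = sum f {1..n}" for f :: "nat \<Rightarrow> real"
    by (metis sum.atLeast_Suc_lessThan_Suc_shift One_nat_def atLeastLessThanSuc_atLeastAtMost comp_def sum.cong)
  have "A *\<^sub>v vec n (\<lambda>_. 1) = 0\<^sub>v n"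
  proof (rule eq_vecI)
    fix i assume "i < dim_vec (0\<^sub>v n :: real vec)"
    hence i: "i < n" by simp
    have "vec_index (A *\<^sub>v vec n (\<lambda>_. 1)) i = (\<Sum>j = 0..<n. (if i = j then 1 else 0) - P (Suc i) (Suc j))"
      using i by (simp add: A_def scalar_prod_def)
    also have "\<dots> = 1 - (\<Sum>j = 0..<n. P (Suc i) (Suc j))"
      using i by (simp add: sum_subtractf)
    also have "\<dots> = 0" using assms(1)[of "Suc i"] i shift[of "P (Suc i)"] by simp
    finally show "vec_index (A *\<^sub>v vec n (\<lambda>_. 1)) i = vec_index (0\<^sub>v n) i" using i by simp
  qed (simp add: A_def)
  moreover have "vec n (\<lambda>_. 1) \<noteq> (0\<^sub>v n :: real vec)"
    using assms(2) by (metis index_vec index_zero_vec(1) zero_neq_one)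
  ultimately have "det A = 0"
    using det_0_iff_vec_prod_zero[OF A] by (metis vec_carrier)
  hence "det A\<^sup>T = 0" using det_transpose[OF A] by simp
  then obtain u where u: "u \<in> carrier_vec n" "u \<noteq> 0\<^sub>v n" "A\<^sup>T *\<^sub>v u = 0\<^sub>v n"
    using det_0_iff_vec_prod_zero[of "A\<^sup>T" n] A by auto
  define v where "v i = vec_index u (i - 1)" for i
  have "\<exists>i<n. vec_index u i \<noteq> 0" using u(1,2) by (metis carrier_vecD eq_vecI index_zero_vec(1,2))
  then obtain i where "i < n" "vec_index u i \<noteq> 0" by blast
  hence "\<exists>i\<in>{1..n}. v i \<noteq> 0" by (intro bexI[of _ "Suc i"]) (auto simp: v_def)
  moreover have "(\<Sum>i\<in>{1..n}. v i * P i j) = v j" if j: "j \<in> {1..n}" for j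
  proof -
    obtain k where k: "j = Suc k" "k < n" using j by (cases j) auto
    have "0 = vec_index (A\<^sup>T *\<^sub>v u) k" using u(3) k by simp
    also have "\<dots> = (\<Sum>i = 0..<n. ((if i = k then 1 else 0) - P (Suc i) (Suc k)) * vec_index u i)"
      using k u(1) by (simp add: A_def scalar_prod_def)
    also have "\<dots> = (\<Sum>i = 0..<n. (if i = k then vec_index u i else 0) - vec_index u i * P (Suc i) (Suc k))"
      by (intro sum.cong) (auto simp: algebra_simps)
    also have "\<dots> = vec_index u k - (\<Sum>i = 0..<n. vec_index u i * P (Suc i) (Suc k))"
      using k by (simp add: sum_subtractf)
    also have "(\<Sum>i = 0..<n. vec_index u i * P (Suc i) (Suc k)) = (\<Sum>i\<in>{1..n}. v i * P i j)"
      using shift[of "\<lambda>i. v i * P i j"] by (simp add: v_def k)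
    finally show ?thesis by (simp add: v_def k)
  qed
  ultimately show ?thesis by blast
qed

text \<open>If \<open>v\<close> is a left fixed vector, the triangle inequality makes its absolute
  value at most its own image under \<open>P\<close>. Both have the same total mass because the rows
  of \<open>P\<close> sum to 1, so equality holds in every entry and normalizing gives the
  distribution.\<close>

lemma stationary_distribution_exists:
  assumes P: "stochastic_matrix n P" and n: "n > 0"
  shows "\<exists>\<pi>. stationary_distribution n P \<pi>"
proof -
  have P0: "0 \<le> P i j" if "i \<in> {1..n}" "j \<in> {1..n}" for i j
    using P that by (auto simp: stochastic_matrix_def)
  have P1: "(\<Sum>j\<in>{1..n}. P i j) = 1" if "i \<in> {1..n}" for i
    using P that by (auto simp: stochastic_matrix_def)
  have "\<exists>v. (\<exists>i\<in>{1..n}. v i \<noteq> 0) \<and> (\<forall>j\<in>{1..n}. (\<Sum>i\<in>{1..n}. v i * P i j) = v j)"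
    using P1 n by (rule markov_fixed_vector)
  then obtain v
    where v: "\<exists>i\<in>{1..n}. v i \<noteq> 0" "\<forall>j\<in>{1..n}. (\<Sum>i\<in>{1..n}. v i * P i j) = v j"
    by (elim exE conjE)
  define u where "u i = \<bar>v i\<bar>" for i
  define s where "s = (\<Sum>i\<in>{1..n}. u i)"
  have le: "u j \<le> (\<Sum>i\<in>{1..n}. u i * P i j)" if "j \<in> {1..n}" for j
  proof -
    have "u j = \<bar>\<Sum>i\<in>{1..n}. v i * P i j\<bar>" using v(2) that by (simp add: u_def)
    also have "\<dots> \<le> (\<Sum>i\<in>{1..n}. \<bar>v i * P i j\<bar>)" by (rule sum_abs)
    also have "\<dots> = (\<Sum>i\<in>{1..n}. u i * P i j)"
      by (intro sum.cong refl) (simp add: u_def abs_mult P0[OF _ that])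
    finally show ?thesis .
  qed
  have "(\<Sum>j\<in>{1..n}. \<Sum>i\<in>{1..n}. u i * P i j) = (\<Sum>i\<in>{1..n}. u i * (\<Sum>j\<in>{1..n}. P i j))"
    by (subst sum.swap) (simp add: sum_distrib_left)
  also have "\<dots> = s" unfolding s_def by (intro sum.cong refl) (simp only: P1 mult_1_right)
  finally have "(\<Sum>j\<in>{1..n}. (\<Sum>i\<in>{1..n}. u i * P i j) - u j) = 0"
    by (simp add: sum_subtractf s_def)
  hence eq: "(\<Sum>i\<in>{1..n}. u i * P i j) = u j" if "j \<in> {1..n}" for j
    using that le by (subst (asm) sum_nonneg_eq_0_iff) (simp_all only: finite_atLeastAtMost diff_ge_0_iff_ge Ball_def right_minus_eq simp_thms)
  have "s > 0"
  proof -
    obtain i where i: "i \<in> {1..n}" "v i \<noteq> 0" using v(1) by blast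
    have "u i \<le> s" unfolding s_def by (rule member_le_sum) (use i in \<open>auto simp: u_def\<close>)
    thus ?thesis using i by (simp add: u_def)
  qed
  define q where "q i = (if i \<in> {1..n} then u i / s else 0)" for i
  have "stationary_distribution n P q"
    unfolding stationary_distribution_def
  proof (intro conjI ballI allI impI)
    show "(\<Sum>i\<in>{1..n}. q i) = 1"
      using \<open>s > 0\<close> by (simp add: q_def s_def flip: sum_divide_distrib)
    fix j assume j: "j \<in> {1..n}"
    have "(\<Sum>i\<in>{1..n}. q i * P i j) = (\<Sum>i\<in>{1..n}. u i * P i j) / s"
      unfolding sum_divide_distrib by (intro sum.cong) (auto simp: q_def)
    thus "(\<Sum>i\<in>{1..n}. q i * P i j) = q j" using eq[OF j] j by (simp add: q_def)
  qed (use P \<open>s > 0\<close> in \<open>auto simp: q_def u_def\<close>)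
  thus ?thesis by blast
qed

section \<open>Coercivity of a perturbed reversible chain\<close>

text \<open>Cauchy-Schwarz in \<open>j\<close> leaves the quadratic form of the Gram matrix
  \<open>G\<close> of the rows, and \<open>u i * u k\<close> is split by the arithmetic-geometric
  mean, using that \<open>G\<close> is symmetric. Absolute row sums are taken of \<open>G\<close>
  and not of \<open>E\<close>, since the entries of \<open>G\<close> still contain the cancellation
  in the sum over \<open>j\<close>.\<close>

lemma bilinear_le_gram:
  fixes E :: "'a \<Rightarrow> 'a \<Rightarrow> real"
  assumes A: "finite A"
    and g: "\<And>i. i \<in> A \<Longrightarrow> (\<Sum>k\<in>A. \<bar>\<Sum>j\<in>A. E i j * E k j\<bar>) \<le> g"
  shows "(\<Sum>i\<in>A. \<Sum>j\<in>A. u i * E i j * v j)\<^sup>2 \<le> g * (\<Sum>i\<in>A. (u i)\<^sup>2) * (\<Sum>i\<in>A. (v i)\<^sup>2)"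
proof -
  define G where "G i k = (\<Sum>j\<in>A. E i j * E k j)" for i k
  have "(\<Sum>i\<in>A. \<Sum>j\<in>A. u i * E i j * v j) = (\<Sum>j\<in>A. (\<Sum>i\<in>A. u i * E i j) * v j)"
    by (subst sum.swap) (simp add: sum_distrib_right)
  hence "(\<Sum>i\<in>A. \<Sum>j\<in>A. u i * E i j * v j)\<^sup>2
      \<le> (\<Sum>j\<in>A. (\<Sum>i\<in>A. u i * E i j)\<^sup>2) * (\<Sum>i\<in>A. (v i)\<^sup>2)"
    using Cauchy_Schwarz_ineq_sum[of "\<lambda>j. \<Sum>i\<in>A. u i * E i j" v A] by simp
  also have "(\<Sum>j\<in>A. (\<Sum>i\<in>A. u i * E i j)\<^sup>2) = (\<Sum>j\<in>A. \<Sum>i\<in>A. \<Sum>k\<in>A. u i * u k * (E i j * E k j))"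
    by (simp add: power2_eq_square sum_product mult_ac)
  also have "\<dots> = (\<Sum>i\<in>A. \<Sum>k\<in>A. u i * u k * G i k)"
    unfolding G_def sum_distrib_left
    by (rule trans[OF sum.swap]) (intro sum.cong refl sum.swap)
  also have "\<dots> \<le> (\<Sum>i\<in>A. \<Sum>k\<in>A. (u i)\<^sup>2 / 2 * \<bar>G i k\<bar> + (u k)\<^sup>2 / 2 * \<bar>G i k\<bar>)"
  proof (intro sum_mono)
    fix i k
    have "0 \<le> (\<bar>u i\<bar> - \<bar>u k\<bar>)\<^sup>2" by simp
    hence "\<bar>u i * u k\<bar> \<le> (u i)\<^sup>2 / 2 + (u k)\<^sup>2 / 2"
      by (simp add: power2_diff abs_mult)
    hence "\<bar>u i * u k\<bar> * \<bar>G i k\<bar> \<le> ((u i)\<^sup>2 / 2 + (u k)\<^sup>2 / 2) * \<bar>G i k\<bar>"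
      by (rule mult_right_mono) simp
    moreover have "u i * u k * G i k \<le> \<bar>u i * u k\<bar> * \<bar>G i k\<bar>"
      by (metis abs_ge_self abs_mult)
    ultimately show "u i * u k * G i k \<le> (u i)\<^sup>2 / 2 * \<bar>G i k\<bar> + (u k)\<^sup>2 / 2 * \<bar>G i k\<bar>"
      by (simp add: algebra_simps)
  qed
  also have "\<dots> = (\<Sum>i\<in>A. \<Sum>k\<in>A. (u i)\<^sup>2 / 2 * \<bar>G i k\<bar>) + (\<Sum>i\<in>A. \<Sum>k\<in>A. (u k)\<^sup>2 / 2 * \<bar>G i k\<bar>)"
    by (simp add: sum.distrib)
  also have "(\<Sum>i\<in>A. \<Sum>k\<in>A. (u k)\<^sup>2 / 2 * \<bar>G i k\<bar>) = (\<Sum>i\<in>A. \<Sum>k\<in>A. (u i)\<^sup>2 / 2 * \<bar>G i k\<bar>)"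
    by (subst sum.swap) (simp add: G_def mult.commute)
  also have "(\<Sum>i\<in>A. \<Sum>k\<in>A. (u i)\<^sup>2 / 2 * \<bar>G i k\<bar>) + (\<Sum>i\<in>A. \<Sum>k\<in>A. (u i)\<^sup>2 / 2 * \<bar>G i k\<bar>)
      = (\<Sum>i\<in>A. (u i)\<^sup>2 * (\<Sum>k\<in>A. \<bar>G i k\<bar>))"
    by (simp add: sum_distrib_left mult.commute flip: sum.distrib)
  also have "\<dots> \<le> (\<Sum>i\<in>A. (u i)\<^sup>2 * g)"
    using g by (intro sum_mono mult_left_mono) (auto simp: G_def)
  also have "\<dots> = g * (\<Sum>i\<in>A. (u i)\<^sup>2)" by (simp add: sum_distrib_left mult.commute)
  finally show ?thesis by (simp add: mult_right_mono sum_nonneg)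
qed

text \<open>
  \<open>drift A \<pi> E D j\<close> is \<open>d\<close> times the \<open>j\<close>-th entry of \<open>D (I - P)\<close>, where \<open>P\<close> has the off-diagonal entries
  \<open>(\<pi>\<^sub>k / (\<pi>\<^sub>j + \<pi>\<^sub>k) + E\<^sub>j\<^sub>k) / d\<close> and unit row sums.
\<close>

definition drift :: "'a set \<Rightarrow> ('a \<Rightarrow> real) \<Rightarrow> ('a \<Rightarrow> 'a \<Rightarrow> real) \<Rightarrow> ('a \<Rightarrow> real) \<Rightarrow> 'a \<Rightarrow> real" where
  "drift A \<pi> E D j = (\<Sum>k\<in>A. (D j * \<pi> k - D k * \<pi> j) / (\<pi> j + \<pi> k) + (D j + D k) * E j k)"

lemma drift_diff: "drift A \<pi> E (\<lambda>i. D i - D' i) j = drift A \<pi> E D j - drift A \<pi> E D' j"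
  unfolding drift_def sum_subtractf[symmetric]
  by (intro sum.cong refl) (simp add: algebra_simps diff_divide_distrib add_divide_distrib)

text \<open>Detailed balance: at D = \<pi> the deterministic part cancels termwise and only the
  perturbation is left.\<close>

lemma drift_self: "drift A \<pi> E \<pi> j = (\<Sum>k\<in>A. (\<pi> j + \<pi> k) * E j k)"
  unfolding drift_def by (intro sum.cong refl) (simp add: mult.commute)

text \<open>The diagonal of \<open>P\<close> is known only through the row sums. Multiplying
  \<open>D j\<close> by the row sum \<open>1\<close> of row \<open>j\<close> makes the diagonal
  terms cancel; on the other side the term \<open>k = j\<close> vanishes because antisymmetry forces
  \<open>E j j = 0\<close>.\<close>

lemma chain_eq_drift:
  fixes P :: "'a \<Rightarrow> 'a \<Rightarrow> real"
  assumes A: "finite A" "j \<in> A"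
    and off: "\<And>i k. i \<in> A \<Longrightarrow> k \<in> A \<Longrightarrow> i \<noteq> k \<Longrightarrow> P i k = (\<pi> k / (\<pi> i + \<pi> k) + E i k) / d"
    and row: "(\<Sum>k\<in>A. P j k) = 1"
    and E: "\<And>i k. i \<in> A \<Longrightarrow> k \<in> A \<Longrightarrow> E i k = - E k i"
    and d: "d > 0"
  shows "D j - (\<Sum>i\<in>A. D i * P i j) = drift A \<pi> E D j / d"
proof -
  have "D j - (\<Sum>i\<in>A. D i * P i j) = D j * (\<Sum>k\<in>A. P j k) - (\<Sum>k\<in>A. D k * P k j)"
    by (simp add: row)
  also have "\<dots> = (\<Sum>k\<in>A. D j * P j k - D k * P k j)"
    by (simp add: sum_distrib_left sum_subtractf)
  also have "\<dots> = (\<Sum>k\<in>A. ((D j * \<pi> k - D k * \<pi> j) / (\<pi> j + \<pi> k) + (D j + D k) * E j k) / d)"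
  proof (intro sum.cong refl)
    fix k assume k: "k \<in> A"
    show "D j * P j k - D k * P k j =
        ((D j * \<pi> k - D k * \<pi> j) / (\<pi> j + \<pi> k) + (D j + D k) * E j k) / d"
    proof (cases "k = j")
      case True
      have "E j j = 0" using E[of j j] A by simp
      thus ?thesis using True by simp
    next
      case False
      have "P j k = (\<pi> k / (\<pi> j + \<pi> k) + E j k) / d" "P k j = (\<pi> j / (\<pi> j + \<pi> k) - E j k) / d"
        using off[of j k] off[of k j] E[of k j] A k False by (auto simp: add.commute)
      hence "D j * P j k - D k * P k j =
          (D j * (\<pi> k / (\<pi> j + \<pi> k) + E j k) - D k * (\<pi> j / (\<pi> j + \<pi> k) - E j k)) / d"
        by (simp add: right_diff_distrib diff_divide_distrib)
      also have "D j * (\<pi> k / (\<pi> j + \<pi> k) + E j k) - D k * (\<pi> j / (\<pi> j + \<pi> k) - E j k) =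
          (D j * \<pi> k - D k * \<pi> j) / (\<pi> j + \<pi> k) + (D j + D k) * E j k"
        by (simp only: times_divide_eq_right diff_divide_distrib ring_distribs)
      finally show ?thesis .
    qed
  qed
  also have "\<dots> = drift A \<pi> E D j / d" by (simp add: drift_def sum_divide_distrib)
  finally show ?thesis .
qed

text \<open>For probability weights \<open>p\<close> and two independent copies of \<open>f\<close>
  this is the identity between the mean squared difference and twice the variance.\<close>

lemma sum_weighted_square_diff:
  fixes p f :: "'a \<Rightarrow> real"
  assumes "sum p A = 1" "(\<Sum>i\<in>A. p i * f i) = 0"
  shows "(\<Sum>i\<in>A. \<Sum>j\<in>A. p i * p j * (f i - f j)\<^sup>2) = 2 * (\<Sum>i\<in>A. p i * (f i)\<^sup>2)"
proof -
  have "(\<Sum>i\<in>A. \<Sum>j\<in>A. p i * p j * (f i - f j)\<^sup>2) =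
     (\<Sum>i\<in>A. \<Sum>j\<in>A. (p i * (f i)\<^sup>2) * p j + p i * (p j * (f j)\<^sup>2) - 2 * ((p i * f i) * (p j * f j)))"
    by (intro sum.cong refl) (simp add: power2_eq_square algebra_simps)
  also have "\<dots> = (\<Sum>i\<in>A. p i * (f i)\<^sup>2) * sum p A + sum p A * (\<Sum>i\<in>A. p i * (f i)\<^sup>2)
      - 2 * ((\<Sum>i\<in>A. p i * f i) * (\<Sum>i\<in>A. p i * f i))"
    by (simp add: sum.distrib sum_subtractf flip: sum_distrib_left sum_product sum_distrib_right)
  finally show ?thesis using assms by simp
qed

text \<open>Testing against \<open>f = D / \<pi>\<close> turns the reversible part into a symmetric
  form with conductances \<open>s\<close>. The noise contributes its row sums on the diagonal, at
  cost \<open>\<rho>\<close>, and one bilinear form in \<open>f\<close> and \<open>D\<close>. Since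
  \<open>s j k \<ge> \<pi> j * \<pi> k / (2 * m)\<close>, the symmetric form dominates that of a
  complete graph, which for \<open>D\<close> of sum 0 is a variance.\<close>

lemma drift_coercive:
  fixes \<pi> D :: "'a \<Rightarrow> real" and E :: "'a \<Rightarrow> 'a \<Rightarrow> real"
  assumes A: "finite A" and \<mu>: "\<mu> > 0" and r: "r \<ge> 0"
    and \<pi>: "\<And>i. i \<in> A \<Longrightarrow> \<mu> \<le> \<pi> i" "\<And>i. i \<in> A \<Longrightarrow> \<pi> i \<le> r\<^sup>2 * \<mu>" "sum \<pi> A = 1"
    and row: "\<And>j. j \<in> A \<Longrightarrow> \<bar>\<Sum>k\<in>A. E j k\<bar> \<le> \<rho>"
    and op: "\<And>u v. \<bar>\<Sum>j\<in>A. \<Sum>k\<in>A. u j * E j k * v k\<bar> \<le> \<kappa> * L2_set u A * L2_set v A"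
    and \<kappa>: "\<kappa> \<ge> 0"
    and D: "sum D A = 0"
  defines "W \<equiv> \<Sum>i\<in>A. (D i)\<^sup>2 / \<pi> i"
  shows "(1 / (2 * r\<^sup>2 * \<mu>) - \<rho> - r * \<kappa>) * W \<le> (\<Sum>j\<in>A. D j / \<pi> j * drift A \<pi> E D j)"
proof -
  have pos: "\<pi> i > 0" if "i \<in> A" for i using \<pi>(1)[OF that] \<mu> by simp
  have "A \<noteq> {}" using \<pi>(3) by auto
  then obtain i0 where "i0 \<in> A" by blast
  hence r0: "r > 0" using \<pi>(2)[of i0] pos[of i0] r by (cases "r = 0") auto
  define m where "m = r\<^sup>2 * \<mu>"
  have m: "m > 0" using r0 \<mu> by (simp add: m_def)
  define f where "f i = D i / \<pi> i" for i
  have Df: "D i = \<pi> i * f i" if "i \<in> A" for i using pos[OF that] by (simp add: f_def)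
  have W: "W = (\<Sum>i\<in>A. \<pi> i * (f i)\<^sup>2)"
    unfolding W_def by (intro sum.cong refl) (use pos in \<open>force simp: f_def power2_eq_square\<close>)
  have W0: "W \<ge> 0" unfolding W using pos by (intro sum_nonneg mult_nonneg_nonneg) (auto intro: less_imp_le)
  define s where "s j k = \<pi> j * \<pi> k / (\<pi> j + \<pi> k)" for j k
  have "(\<Sum>j\<in>A. D j / \<pi> j * drift A \<pi> E D j) =
      (\<Sum>j\<in>A. \<Sum>k\<in>A. s j k * (f j * (f j - f k)) + (f j * D j * E j k + f j * E j k * D k))"
    unfolding drift_def sum_distrib_left f_def[symmetric]
  proof (intro sum.cong refl)
    fix j k assume "j \<in> A" "k \<in> A"
    thus "f j * ((D j * \<pi> k - D k * \<pi> j) / (\<pi> j + \<pi> k) + (D j + D k) * E j k) =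
        s j k * (f j * (f j - f k)) + (f j * D j * E j k + f j * E j k * D k)"
      by (simp add: Df s_def algebra_simps diff_divide_distrib)
  qed
  also have "\<dots> = (\<Sum>j\<in>A. \<Sum>k\<in>A. s j k * (f j * (f j - f k)))
      + (\<Sum>j\<in>A. f j * D j * (\<Sum>k\<in>A. E j k)) + (\<Sum>j\<in>A. \<Sum>k\<in>A. f j * E j k * D k)"
    by (simp add: sum.distrib sum_distrib_left)
  finally have split: "(\<Sum>j\<in>A. D j / \<pi> j * drift A \<pi> E D j) = \<dots>" .
  \<comment> \<open>As \<open>s\<close> is symmetric, averaging the sum with its transpose produces
    half of the sum of \<open>s j k * (f j - f k)^2\<close>.\<close>
  have "(\<Sum>j\<in>A. \<Sum>k\<in>A. s j k * (f j * (f j - f k))) = (\<Sum>j\<in>A. \<Sum>k\<in>A. s j k * (f k * (f k - f j)))"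
    by (subst sum.swap) (simp add: s_def mult.commute add.commute)
  hence "2 * (\<Sum>j\<in>A. \<Sum>k\<in>A. s j k * (f j * (f j - f k))) =
     (\<Sum>j\<in>A. \<Sum>k\<in>A. s j k * (f j * (f j - f k)) + s j k * (f k * (f k - f j)))"
    by (simp add: sum.distrib)
  also have "\<dots> = (\<Sum>j\<in>A. \<Sum>k\<in>A. s j k * (f j - f k)\<^sup>2)"
    by (intro sum.cong refl) (simp add: power2_eq_square algebra_simps)
  also have "\<dots> \<ge> (\<Sum>j\<in>A. \<Sum>k\<in>A. 1 / (2 * m) * (\<pi> j * \<pi> k * (f j - f k)\<^sup>2))"
  proof (intro sum_mono)
    fix j k assume jk: "j \<in> A" "k \<in> A"
    have "\<pi> j + \<pi> k \<le> 2 * m" using \<pi>(2)[OF jk(1)] \<pi>(2)[OF jk(2)] by (simp add: m_def)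
    hence "\<pi> j * \<pi> k / (2 * m) \<le> s j k"
      unfolding s_def using pos[OF jk(1)] pos[OF jk(2)] by (intro divide_left_mono) (auto intro!: mult_pos_pos m)
    from mult_right_mono[OF this, of "(f j - f k)\<^sup>2"]
    show "1 / (2 * m) * (\<pi> j * \<pi> k * (f j - f k)\<^sup>2) \<le> s j k * (f j - f k)\<^sup>2" by simp
  qed
  also have "(\<Sum>j\<in>A. \<Sum>k\<in>A. 1 / (2 * m) * (\<pi> j * \<pi> k * (f j - f k)\<^sup>2)) = 1 / (2 * m) * (2 * W)"
  proof -
    have "(\<Sum>i\<in>A. \<pi> i * f i) = 0" using D Df by simp
    thus ?thesis using sum_weighted_square_diff[OF \<pi>(3), of f] by (simp only: W flip: sum_distrib_left)
  qed
  finally have main: "1 / (2 * m) * W \<le> (\<Sum>j\<in>A. \<Sum>k\<in>A. s j k * (f j * (f j - f k)))" by simp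
  have "\<bar>\<Sum>j\<in>A. f j * D j * (\<Sum>k\<in>A. E j k)\<bar> \<le> (\<Sum>j\<in>A. \<pi> j * (f j)\<^sup>2 * \<rho>)"
  proof (rule order_trans[OF sum_abs], intro sum_mono)
    fix j assume j: "j \<in> A"
    have "f j * D j = \<pi> j * (f j)\<^sup>2" using Df[OF j] by (simp add: power2_eq_square)
    moreover have "\<pi> j * (f j)\<^sup>2 * \<bar>\<Sum>k\<in>A. E j k\<bar> \<le> \<pi> j * (f j)\<^sup>2 * \<rho>"
      using row[OF j] pos[OF j] by (intro mult_left_mono) auto
    ultimately show "\<bar>f j * D j * (\<Sum>k\<in>A. E j k)\<bar> \<le> \<pi> j * (f j)\<^sup>2 * \<rho>"
      using pos[OF j] by (simp add: abs_mult)
  qed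
  also have "\<dots> = \<rho> * W" by (simp add: W sum_distrib_left mult.commute)
  finally have diag: "\<bar>\<Sum>j\<in>A. f j * D j * (\<Sum>k\<in>A. E j k)\<bar> \<le> \<rho> * W" .
  have "(\<Sum>i\<in>A. (f i)\<^sup>2) \<le> (\<Sum>i\<in>A. \<pi> i * (f i)\<^sup>2 / \<mu>)"
  proof (intro sum_mono)
    fix i assume "i \<in> A"
    hence "\<mu> * (f i)\<^sup>2 \<le> \<pi> i * (f i)\<^sup>2" using \<pi>(1) by (intro mult_right_mono) auto
    thus "(f i)\<^sup>2 \<le> \<pi> i * (f i)\<^sup>2 / \<mu>" using \<mu> by (simp add: field_simps)
  qed
  hence f2: "(\<Sum>i\<in>A. (f i)\<^sup>2) \<le> W / \<mu>" by (simp add: W sum_divide_distrib)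
  have "(\<Sum>i\<in>A. (D i)\<^sup>2) \<le> (\<Sum>i\<in>A. m * (\<pi> i * (f i)\<^sup>2))"
  proof (intro sum_mono)
    fix i assume i: "i \<in> A"
    have "(D i)\<^sup>2 = \<pi> i * (\<pi> i * (f i)\<^sup>2)" using Df[OF i] by (simp add: power2_eq_square)
    also have "\<dots> \<le> m * (\<pi> i * (f i)\<^sup>2)" using \<pi>(2)[OF i] pos[OF i]
      by (intro mult_right_mono) (auto simp: m_def)
    finally show "(D i)\<^sup>2 \<le> m * (\<pi> i * (f i)\<^sup>2)" .
  qed
  hence D2: "(\<Sum>i\<in>A. (D i)\<^sup>2) \<le> m * W" by (simp add: W sum_distrib_left)
  \<comment> \<open>The two vectors live on different scales: the first norm is at most
    \<open>sqrt (W / \<mu>)\<close>, the second at most \<open>sqrt (m * W)\<close>. The mismatch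
    \<open>sqrt (m / \<mu>) = r\<close> is the factor in front of \<open>\<kappa>\<close>.\<close>
  have "L2_set f A * L2_set D A = sqrt ((\<Sum>i\<in>A. (f i)\<^sup>2) * (\<Sum>i\<in>A. (D i)\<^sup>2))"
    by (simp add: L2_set_def real_sqrt_mult)
  also have "\<dots> \<le> sqrt (W / \<mu> * (m * W))"
    using f2 D2 W0 \<mu> by (intro real_sqrt_le_mono mult_mono) (auto intro: sum_nonneg)
  also have "W / \<mu> * (m * W) = (r * W)\<^sup>2" using \<mu> by (simp add: m_def power2_eq_square)
  also have "sqrt ((r * W)\<^sup>2) = r * W" using r W0 by simp
  finally have "L2_set f A * L2_set D A \<le> r * W" .
  hence "\<kappa> * (L2_set f A * L2_set D A) \<le> \<kappa> * (r * W)" using \<kappa> by (rule mult_left_mono)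
  hence off: "\<bar>\<Sum>j\<in>A. \<Sum>k\<in>A. f j * E j k * D k\<bar> \<le> r * \<kappa> * W"
    using op[of f D] by (simp add: mult_ac)
  have "(1 / (2 * r\<^sup>2 * \<mu>) - \<rho> - r * \<kappa>) * W = 1 / (2 * m) * W - \<rho> * W - r * \<kappa> * W"
    by (simp add: m_def algebra_simps)
  thus ?thesis using main diag off unfolding split by linarith
qed

text \<open>Coercivity and Cauchy-Schwarz bound \<open>c * W\<close> by the norm of
  \<open>D / \<pi>\<close> times that of the drift. One factor \<open>sqrt W\<close> is divided out;
  passing from \<open>W\<close> to the plain norms of \<open>D / \<pi>\<close> and \<open>D\<close>
  costs \<open>1 / sqrt \<mu>\<close> and \<open>r * sqrt \<mu>\<close>, so that only
  \<open>r\<close> survives.\<close>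

lemma drift_perturbation:
  fixes \<pi> D :: "'a \<Rightarrow> real" and E :: "'a \<Rightarrow> 'a \<Rightarrow> real"
  assumes A: "finite A" and \<mu>: "\<mu> > 0" and r: "r \<ge> 0"
    and \<pi>: "\<And>i. i \<in> A \<Longrightarrow> \<mu> \<le> \<pi> i" "\<And>i. i \<in> A \<Longrightarrow> \<pi> i \<le> r\<^sup>2 * \<mu>" "sum \<pi> A = 1"
    and row: "\<And>j. j \<in> A \<Longrightarrow> \<bar>\<Sum>k\<in>A. E j k\<bar> \<le> \<rho>"
    and op: "\<And>u v. \<bar>\<Sum>j\<in>A. \<Sum>k\<in>A. u j * E j k * v k\<bar> \<le> \<kappa> * L2_set u A * L2_set v A"
    and \<kappa>: "\<kappa> \<ge> 0"
    and D: "sum D A = 0"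
    and c: "c > 0" "c \<le> 1 / (2 * r\<^sup>2 * \<mu>) - \<rho> - r * \<kappa>"
  shows "L2_set D A \<le> r / c * L2_set (drift A \<pi> E D) A"
proof -
  define W where "W = (\<Sum>i\<in>A. (D i)\<^sup>2 / \<pi> i)"
  have pos: "\<pi> i > 0" if "i \<in> A" for i using \<pi>(1)[OF that] \<mu> by simp
  have W0: "W \<ge> 0" unfolding W_def using pos by (intro sum_nonneg divide_nonneg_nonneg) (auto intro: less_imp_le)
  have "c * W \<le> (\<Sum>j\<in>A. D j / \<pi> j * drift A \<pi> E D j)"
    using mult_right_mono[OF c(2) W0] drift_coercive[OF A \<mu> r \<pi> row op \<kappa> D] unfolding W_def by linarith
  also have "\<dots> \<le> (\<Sum>j\<in>A. \<bar>D j / \<pi> j\<bar> * \<bar>drift A \<pi> E D j\<bar>)"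
    by (intro sum_mono) (metis abs_ge_self abs_mult)
  also have "\<dots> \<le> L2_set (\<lambda>j. D j / \<pi> j) A * L2_set (drift A \<pi> E D) A"
    by (rule L2_set_mult_ineq)
  also have "L2_set (\<lambda>j. D j / \<pi> j) A \<le> sqrt (W / \<mu>)"
    unfolding L2_set_def W_def sum_divide_distrib
  proof (intro real_sqrt_le_mono sum_mono)
    fix i assume i: "i \<in> A"
    have "(D i)\<^sup>2 / \<pi> i / \<pi> i \<le> (D i)\<^sup>2 / \<pi> i / \<mu>"
      using \<pi>(1)[OF i] pos[OF i] \<mu> by (intro divide_left_mono) auto
    thus "(D i / \<pi> i)\<^sup>2 \<le> (D i)\<^sup>2 / \<pi> i / \<mu>" by (simp add: power2_eq_square)
  qed
  finally have 1: "c * W \<le> sqrt (W / \<mu>) * L2_set (drift A \<pi> E D) A"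
    by (simp add: mult_right_mono)
  have 2: "L2_set D A \<le> r * sqrt \<mu> * sqrt W"
  proof -
    have "(\<Sum>i\<in>A. (D i)\<^sup>2) \<le> (\<Sum>i\<in>A. r\<^sup>2 * \<mu> * ((D i)\<^sup>2 / \<pi> i))"
    proof (intro sum_mono)
      fix i assume i: "i \<in> A"
      have "\<pi> i * ((D i)\<^sup>2 / \<pi> i) \<le> r\<^sup>2 * \<mu> * ((D i)\<^sup>2 / \<pi> i)"
        using \<pi>(2)[OF i] pos[OF i] by (intro mult_right_mono) auto
      thus "(D i)\<^sup>2 \<le> r\<^sup>2 * \<mu> * ((D i)\<^sup>2 / \<pi> i)" using pos[OF i] by simp
    qed
    hence "L2_set D A \<le> sqrt (r\<^sup>2 * \<mu> * W)"
      unfolding L2_set_def W_def sum_distrib_left by (rule real_sqrt_le_mono)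
    thus ?thesis using r by (simp add: real_sqrt_mult)
  qed
  show ?thesis
  proof (cases "W = 0")
    case True
    hence "L2_set D A \<le> 0" using 2 by simp
    thus ?thesis using r c by (meson L2_set_nonneg divide_nonneg_pos mult_nonneg_nonneg order_trans)
  next
    case False
    hence Wp: "sqrt W > 0" using W0 by simp
    have "c * (sqrt W * sqrt W) \<le> sqrt W / sqrt \<mu> * L2_set (drift A \<pi> E D) A"
      using 1 W0 by (simp add: real_sqrt_divide)
    hence "sqrt W * (c * sqrt W) \<le> sqrt W * (L2_set (drift A \<pi> E D) A / sqrt \<mu>)"
      by (simp only: mult.left_commute[of "sqrt W" c] times_divide_eq_left times_divide_eq_right)
    hence "c * sqrt W \<le> L2_set (drift A \<pi> E D) A / sqrt \<mu>"
      using Wp by (rule mult_left_le_imp_le)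
    hence "c * sqrt W * sqrt \<mu> \<le> L2_set (drift A \<pi> E D) A"
      using \<mu> by (subst (asm) pos_le_divide_eq) simp_all
    hence "sqrt \<mu> * sqrt W \<le> L2_set (drift A \<pi> E D) A / c"
      using c by (subst pos_le_divide_eq) (simp_all add: mult_ac)
    from mult_left_mono[OF this r] 2 show ?thesis by (simp add: mult_ac)
  qed
qed

lemma sum_abs_le_L2_set: "(\<Sum>i\<in>A. \<bar>u i\<bar>) \<le> sqrt (real (card A)) * L2_set u A"
  using L2_set_mult_ineq[of "\<lambda>_. 1" u A] by (simp add: L2_set_def)

text \<open>Used for the bias, whose entries may all have the same size with no cancellation; there
  the factor \<open>card A\<close> is the natural one.\<close>

lemma bilinear_le_entrywise:
  fixes B :: "'a \<Rightarrow> 'a \<Rightarrow> real"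
  assumes B: "\<And>i j. i \<in> A \<Longrightarrow> j \<in> A \<Longrightarrow> \<bar>B i j\<bar> \<le> \<beta>" and \<beta>: "\<beta> \<ge> 0"
  shows "\<bar>\<Sum>i\<in>A. \<Sum>j\<in>A. u i * B i j * v j\<bar> \<le> \<beta> * card A * L2_set u A * L2_set v A"
proof -
  have "\<bar>\<Sum>i\<in>A. \<Sum>j\<in>A. u i * B i j * v j\<bar> \<le> (\<Sum>i\<in>A. \<Sum>j\<in>A. \<bar>u i * B i j * v j\<bar>)"
    by (rule order_trans[OF sum_abs]) (intro sum_mono sum_abs)
  also have "\<dots> \<le> (\<Sum>i\<in>A. \<Sum>j\<in>A. \<beta> * (\<bar>u i\<bar> * \<bar>v j\<bar>))"
  proof (intro sum_mono)
    fix i j assume "i \<in> A" "j \<in> A"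
    from mult_right_mono[OF B[OF this], of "\<bar>u i\<bar> * \<bar>v j\<bar>"]
    show "\<bar>u i * B i j * v j\<bar> \<le> \<beta> * (\<bar>u i\<bar> * \<bar>v j\<bar>)" by (simp add: abs_mult mult_ac)
  qed
  also have "\<dots> = \<beta> * ((\<Sum>i\<in>A. \<bar>u i\<bar>) * (\<Sum>j\<in>A. \<bar>v j\<bar>))"
    by (subst sum_product) (simp add: sum_distrib_left)
  also have "\<dots> \<le> \<beta> * ((sqrt (real (card A)) * L2_set u A) * (sqrt (real (card A)) * L2_set v A))"
    using \<beta> by (intro mult_left_mono mult_mono sum_abs_le_L2_set) (auto intro: sum_nonneg mult_nonneg_nonneg)
  also have "\<dots> = \<beta> * card A * L2_set u A * L2_set v A"
    by (simp add: mult_ac flip: mult.assoc[of "sqrt _" "sqrt _"])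
  finally show ?thesis .
qed

text \<open>The deterministic core: \<open>X\<close> is the noise, \<open>B\<close> the bias,
  \<open>v\<close> the variance level of an entry of \<open>X\<close>, and \<open>x\<close> will be
  \<open>v * ln n\<close>. Coercivity is applied twice to vectors of sum 0. A difference of two
  stationary distributions has zero drift and hence vanishes; the difference to \<pi> has drift
  equal to minus the drift of \<pi>.\<close>

lemma stationary_distribution_perturbation:
  fixes n :: nat and r d x v \<beta> :: real and \<pi> :: "nat \<Rightarrow> real" and X B P :: "nat \<Rightarrow> nat \<Rightarrow> real"
  defines "A \<equiv> {1..n}"
  assumes n: "n > 0" and r: "r \<ge> 1" and d: "d > 0"
    and \<pi>: "\<And>i. i \<in> A \<Longrightarrow> \<pi> i > 0" "sum \<pi> A = 1" "\<And>i j. i \<in> A \<Longrightarrow> j \<in> A \<Longrightarrow> \<pi> i \<le> r\<^sup>2 * \<pi> j"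
    and P: "stochastic_matrix n P"
    and off: "\<And>i k. i \<in> A \<Longrightarrow> k \<in> A \<Longrightarrow> i \<noteq> k \<Longrightarrow> P i k = (\<pi> k / (\<pi> i + \<pi> k) + (X i k + B i k)) / d"
    and X: "\<And>i k. i \<in> A \<Longrightarrow> k \<in> A \<Longrightarrow> X i k = - X k i"
    and B: "\<And>i k. i \<in> A \<Longrightarrow> k \<in> A \<Longrightarrow> B i k = - B k i" "\<And>i k. i \<in> A \<Longrightarrow> k \<in> A \<Longrightarrow> \<bar>B i k\<bar> \<le> \<beta>"
    and row: "\<And>i. i \<in> A \<Longrightarrow> (\<Sum>k\<in>A. X i k)\<^sup>2 \<le> 7 * x * n"
    and gram: "\<And>i. i \<in> A \<Longrightarrow> (\<Sum>k\<in>A. \<bar>\<Sum>j\<in>A. X i j * X k j\<bar>) \<le> 14 * x * n * sqrt n"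
    and lin: "(\<Sum>j\<in>A. (\<Sum>k\<in>A. (\<pi> j + \<pi> k) * X j k)\<^sup>2) \<le> 4 * n\<^sup>2 * v * (2 * r\<^sup>2 / n)\<^sup>2"
    and x: "x \<ge> 0" "3584 * x * r ^ 6 \<le> sqrt n" "1792 * x * r ^ 4 \<le> n"
    and \<beta>: "\<beta> \<ge> 0" "16 * r ^ 3 * \<beta> \<le> 1"
  shows "\<exists>\<rho>. stationary_distribution n P \<rho> \<and> (\<forall>\<rho>'. stationary_distribution n P \<rho>' \<longrightarrow> \<rho>' = \<rho>) \<and>
    L2_set (\<lambda>i. \<rho> i - \<pi> i) A / L2_set \<pi> A \<le> 16 * r ^ 5 * sqrt (v / n) + 8 * r ^ 3 * \<beta>"
proof -
  define E where "E i k = X i k + B i k" for i k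
  have A: "finite A" "A \<noteq> {}" "card A = n" using n by (auto simp: A_def)
  obtain i0 where i0: "i0 \<in> A" "\<And>i. i \<in> A \<Longrightarrow> \<pi> i0 \<le> \<pi> i"
    using ex_min_if_finite[of "\<pi> ` A"] A by (force simp: not_less)
  define \<mu> where "\<mu> = \<pi> i0"
  have \<mu>: "\<mu> > 0" using \<pi>(1) i0 by (simp add: \<mu>_def)
  have \<pi>_lo: "\<mu> \<le> \<pi> i" and \<pi>_hi: "\<pi> i \<le> r\<^sup>2 * \<mu>" if "i \<in> A" for i
    using i0 \<pi>(3) that by (auto simp: \<mu>_def)
  have "n * \<mu> \<le> 1" using sum_mono[of A "\<lambda>_. \<mu>" \<pi>] \<pi>_lo \<pi>(2) A by simp
  \<comment> \<open>Since the least entry \<mu> is at most \<open>1/n\<close>, the main term is at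
    least \<open>n / (2 * r^2)\<close>. Half of it is kept as \<open>c\<close>. The other half pays
    for row sums, Gram bound and bias with \<open>n / (16 * r^2)\<close>,
    \<open>n / (16 * r^2)\<close> and \<open>n / (8 * r^2)\<close>; the constants 1792 = 7 * 256 and
    3584 = 14 * 256 come from squaring the first two.\<close>
  define c where "c = n / (4 * r\<^sup>2)"
  define \<rho> where "\<rho> = sqrt (7 * x * n) + n * \<beta>"
  define \<kappa> where "\<kappa> = sqrt (14 * x * n * sqrt n) + \<beta> * n"
  have c: "c > 0" using n r by (simp add: c_def)
  have \<kappa>: "\<kappa> \<ge> 0" using x \<beta> by (simp add: \<kappa>_def)
  have E_anti: "E i k = - E k i" if "i \<in> A" "k \<in> A" for i k
    using X[OF that] B(1)[OF that] by (simp add: E_def)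
  have E_row: "\<bar>\<Sum>k\<in>A. E j k\<bar> \<le> \<rho>" if j: "j \<in> A" for j
  proof -
    have "\<bar>\<Sum>k\<in>A. X j k\<bar> \<le> sqrt (7 * x * n)" using row[OF j] by (rule real_le_rsqrt[of "\<bar>_\<bar>", simplified])
    moreover have "\<bar>\<Sum>k\<in>A. B j k\<bar> \<le> n * \<beta>"
      using sum_mono[of A "\<lambda>k. \<bar>B j k\<bar>" "\<lambda>_. \<beta>"] B(2)[OF j] A
      by (intro order_trans[OF sum_abs]) simp
    ultimately show ?thesis by (simp add: E_def sum.distrib \<rho>_def)
  qed
  have E_op: "\<bar>\<Sum>j\<in>A. \<Sum>k\<in>A. u j * E j k * v k\<bar> \<le> \<kappa> * L2_set u A * L2_set v A" for u v
  proof -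
    have "\<bar>\<Sum>j\<in>A. \<Sum>k\<in>A. u j * X j k * v k\<bar> \<le>
        sqrt (14 * x * n * sqrt n * (\<Sum>i\<in>A. (u i)\<^sup>2) * (\<Sum>i\<in>A. (v i)\<^sup>2))"
      using bilinear_le_gram[OF A(1) gram, of u v] by (intro real_le_rsqrt) simp
    hence "\<bar>\<Sum>j\<in>A. \<Sum>k\<in>A. u j * X j k * v k\<bar> \<le> sqrt (14 * x * n * sqrt n) * L2_set u A * L2_set v A"
      by (simp add: L2_set_def real_sqrt_mult)
    moreover have "\<bar>\<Sum>j\<in>A. \<Sum>k\<in>A. u j * B j k * v k\<bar> \<le> \<beta> * n * L2_set u A * L2_set v A"
      unfolding A(3)[symmetric] by (rule bilinear_le_entrywise[OF B(2) \<beta>(1)])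
    moreover have "(\<Sum>j\<in>A. \<Sum>k\<in>A. u j * E j k * v k) =
        (\<Sum>j\<in>A. \<Sum>k\<in>A. u j * X j k * v k) + (\<Sum>j\<in>A. \<Sum>k\<in>A. u j * B j k * v k)"
      by (simp add: E_def algebra_simps sum.distrib)
    ultimately show ?thesis by (simp add: \<kappa>_def algebra_simps)
  qed
  have c_le: "c \<le> 1 / (2 * r\<^sup>2 * \<mu>) - \<rho> - r * \<kappa>"
  proof -
    have "sqrt (7 * x * n) \<le> n / (16 * r\<^sup>2)"
    proof (rule real_le_lsqrt)
      have "1792 * x * r ^ 4 * n \<le> real n * n" using x(3) by (intro mult_right_mono) auto
      moreover have "(n / (16 * r\<^sup>2))\<^sup>2 = real n * n / (256 * r ^ 4)"
        by (simp add: power_divide power_mult_distrib power2_eq_square[of "real n"] flip: power_mult)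
      ultimately show "7 * x * n \<le> (n / (16 * r\<^sup>2))\<^sup>2"
        using r by (simp add: pos_le_divide_eq mult_ac)
    qed (use r in auto)
    moreover have "r * sqrt (14 * x * n * sqrt n) \<le> n / (16 * r\<^sup>2)"
    proof -
      have "sqrt (14 * x * n * sqrt n) \<le> n / (16 * r ^ 3)"
      proof (rule real_le_lsqrt)
        have "3584 * x * r ^ 6 * (n * sqrt n) \<le> sqrt n * (n * sqrt n)" using x(2) by (intro mult_right_mono) auto
        also have "\<dots> = real n * n" by simp
        finally have "3584 * x * r ^ 6 * (n * sqrt n) \<le> real n * n" .
        moreover have "(n / (16 * r ^ 3))\<^sup>2 = real n * n / (256 * r ^ 6)"
          by (simp add: power_divide power_mult_distrib power2_eq_square[of "real n"] flip: power_mult)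
        ultimately show "14 * x * n * sqrt n \<le> (n / (16 * r ^ 3))\<^sup>2"
          using r by (simp add: pos_le_divide_eq mult_ac)
      qed (use r in auto)
      from mult_left_mono[OF this, of r] show ?thesis
        using r by (simp add: power3_eq_cube power2_eq_square)
    qed
    moreover have "n * \<beta> + r * (\<beta> * n) \<le> n / (8 * r\<^sup>2)"
    proof -
      have "n * \<beta> + r * (\<beta> * n) \<le> 2 * r * (\<beta> * n)" using r \<beta> mult_right_mono[of 1 r "\<beta> * n"] by (simp add: mult_ac)
      also have "\<dots> = (16 * r ^ 3 * \<beta>) * (n / (8 * r\<^sup>2))"
        using r by (simp add: power3_eq_cube power2_eq_square)
      also have "\<dots> \<le> 1 * (n / (8 * r\<^sup>2))" using \<beta> by (intro mult_right_mono) auto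
      finally show ?thesis by simp
    qed
    moreover have "n / (2 * r\<^sup>2) \<le> 1 / (2 * r\<^sup>2 * \<mu>)"
      using \<open>n * \<mu> \<le> 1\<close> \<mu> r by (simp add: field_simps)
    ultimately show ?thesis
      using n r by (simp add: c_def \<rho>_def \<kappa>_def algebra_simps)
  qed
  have bound: "L2_set D A \<le> r / c * L2_set (drift A \<pi> E D) A" if "sum D A = 0" for D
    by (rule drift_perturbation[OF A(1) \<mu> _ \<pi>_lo \<pi>_hi \<pi>(2) E_row E_op \<kappa> that c c_le]) (use r in auto)
  have stat_drift: "drift A \<pi> E q j = 0" if q: "stationary_distribution n P q" and j: "j \<in> A" for q j
  proof -
    have "(\<Sum>k\<in>A. P j k) = 1" using P j by (auto simp: stochastic_matrix_def A_def)
    from chain_eq_drift[where P = P and E = E and \<pi> = \<pi> and D = q, OF A(1) j off[folded E_def] this E_anti d]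
    show ?thesis using q j d by (simp add: stationary_distribution_def A_def)
  qed
  obtain q where q: "stationary_distribution n P q"
    using stationary_distribution_exists[OF P n] by blast
  have q1: "sum s A = 1" if "stationary_distribution n P s" for s
    using that by (simp add: stationary_distribution_def A_def)
  have uniq: "q' = q" if q': "stationary_distribution n P q'" for q'
  proof -
    define D where "D i = q' i - q i" for i
    have "sum D A = 0" using q1[OF q] q1[OF q'] by (simp add: D_def[abs_def] sum_subtractf)
    hence "L2_set D A \<le> r / c * L2_set (drift A \<pi> E D) A" by (rule bound)
    also have "L2_set (drift A \<pi> E D) A = 0"
      unfolding L2_set_def D_def[abs_def] by (simp add: drift_diff stat_drift q q')
    finally have "L2_set D A = 0" by (simp add: antisym)
    hence "D i = 0" if "i \<in> A" for i using that A by (simp add: L2_set_eq_0_iff)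
    hence "q' i = q i" for i
      using q q' by (cases "i \<in> A") (auto simp: D_def stationary_distribution_def A_def)
    thus ?thesis by auto
  qed
  \<comment> \<open>This lower bound on the norm of \<pi> converts absolute errors into relative
    ones, and is the source of the extra \<open>1 / sqrt n\<close> in the rate.\<close>
  have L1: "1 \<le> sqrt n * L2_set \<pi> A"
    using sum_abs_le_L2_set[of \<pi> A] \<pi>(1,2) A by (simp add: abs_of_pos cong: sum.cong)
  define D where "D i = q i - \<pi> i" for i
  have "sum D A = 0" using q1[OF q] \<pi>(2) by (simp add: D_def[abs_def] sum_subtractf)
  hence "L2_set D A \<le> r / c * L2_set (drift A \<pi> E D) A" by (rule bound)
  also have "L2_set (drift A \<pi> E D) A = L2_set (\<lambda>j. (\<Sum>k\<in>A. (\<pi> j + \<pi> k) * X j k) + (\<Sum>k\<in>A. (\<pi> j + \<pi> k) * B j k)) A"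
  proof -
    have "drift A \<pi> E D j = - ((\<Sum>k\<in>A. (\<pi> j + \<pi> k) * X j k) + (\<Sum>k\<in>A. (\<pi> j + \<pi> k) * B j k))" if "j \<in> A" for j
      using stat_drift[OF q that]
      by (simp add: D_def[abs_def] drift_diff drift_self E_def distrib_left sum.distrib)
    thus ?thesis unfolding L2_set_def by (intro arg_cong[where f = sqrt] sum.cong refl) (simp only: power2_minus)
  qed
  also have "r / c * \<dots> \<le> r / c * (4 * r\<^sup>2 * sqrt v + 2 * \<beta> * n * L2_set \<pi> A)"
  proof (intro mult_left_mono)
    have "L2_set (\<lambda>j. \<Sum>k\<in>A. (\<pi> j + \<pi> k) * X j k) A \<le> sqrt (4 * n\<^sup>2 * v * (2 * r\<^sup>2 / n)\<^sup>2)"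
      unfolding L2_set_def using lin by (rule real_sqrt_le_mono)
    also have "4 * n\<^sup>2 * v * (2 * r\<^sup>2 / n)\<^sup>2 = (4 * r\<^sup>2)\<^sup>2 * v"
      using n by (simp add: field_simps power2_eq_square)
    also have "sqrt \<dots> = 4 * r\<^sup>2 * sqrt v"
      unfolding real_sqrt_mult real_sqrt_abs by simp
    finally have 1: "L2_set (\<lambda>j. \<Sum>k\<in>A. (\<pi> j + \<pi> k) * X j k) A \<le> 4 * r\<^sup>2 * sqrt v" .
    have "L2_set (\<lambda>j. \<Sum>k\<in>A. (\<pi> j + \<pi> k) * B j k) A \<le> L2_set (\<lambda>j. n * \<beta> * \<pi> j + \<beta>) A"
      unfolding L2_set_def
    proof (intro real_sqrt_le_mono sum_mono)
      fix j assume j: "j \<in> A"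
      have "\<bar>\<Sum>k\<in>A. (\<pi> j + \<pi> k) * B j k\<bar> \<le> (\<Sum>k\<in>A. (\<pi> j + \<pi> k) * \<beta>)"
      proof (rule order_trans[OF sum_abs], intro sum_mono)
        fix k assume k: "k \<in> A"
        show "\<bar>(\<pi> j + \<pi> k) * B j k\<bar> \<le> (\<pi> j + \<pi> k) * \<beta>"
          using B(2)[OF j k] \<pi>(1)[OF j] \<pi>(1)[OF k] by (simp add: abs_mult mult_left_mono)
      qed
      also have "\<dots> = n * \<beta> * \<pi> j + \<beta>"
        using A \<pi>(2) by (simp add: sum.distrib algebra_simps flip: sum_distrib_left sum_distrib_right)
      finally show "(\<Sum>k\<in>A. (\<pi> j + \<pi> k) * B j k)\<^sup>2 \<le> (n * \<beta> * \<pi> j + \<beta>)\<^sup>2"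
        by (metis abs_ge_zero power2_abs power_mono)
    qed
    also have "\<dots> \<le> L2_set (\<lambda>j. n * \<beta> * \<pi> j) A + L2_set (\<lambda>j. \<beta>) A" by (rule L2_set_triangle_ineq)
    also have "L2_set (\<lambda>j. n * \<beta> * \<pi> j) A = n * \<beta> * L2_set \<pi> A"
      using \<beta> by (simp add: L2_set_right_distrib)
    also have "L2_set (\<lambda>j. \<beta>) A \<le> n * \<beta> * L2_set \<pi> A"
    proof -
      have "\<beta> * sqrt n * 1 \<le> \<beta> * sqrt n * (sqrt n * L2_set \<pi> A)"
        using L1 \<beta> by (intro mult_left_mono) auto
      also have "\<dots> = n * \<beta> * L2_set \<pi> A"
        by (simp add: mult.assoc[symmetric])
      finally show ?thesis using A \<beta> by (simp add: L2_set_def real_sqrt_mult mult.commute)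
    qed
    finally have 2: "L2_set (\<lambda>j. \<Sum>k\<in>A. (\<pi> j + \<pi> k) * B j k) A \<le> 2 * \<beta> * n * L2_set \<pi> A" by simp
    show "L2_set (\<lambda>j. (\<Sum>k\<in>A. (\<pi> j + \<pi> k) * X j k) + (\<Sum>k\<in>A. (\<pi> j + \<pi> k) * B j k)) A
        \<le> 4 * r\<^sup>2 * sqrt v + 2 * \<beta> * n * L2_set \<pi> A"
      using 1 2 by (intro order_trans[OF L2_set_triangle_ineq]) simp
  qed (use r c in auto)
  finally have D_le: "L2_set D A \<le> r / c * (4 * r\<^sup>2 * sqrt v + 2 * \<beta> * n * L2_set \<pi> A)" .
  have Lpos: "L2_set \<pi> A > 0"
    using L1 L2_set_nonneg[of \<pi> A] by (cases "L2_set \<pi> A = 0") (auto simp: less_le)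
  have "v \<ge> 0"
  proof -
    have "0 \<le> (\<Sum>j\<in>A. (\<Sum>k\<in>A. (\<pi> j + \<pi> k) * X j k)\<^sup>2)" by (simp add: sum_nonneg)
    also have "\<dots> \<le> 4 * n\<^sup>2 * v * (2 * r\<^sup>2 / n)\<^sup>2" by (rule lin)
    also have "\<dots> = 16 * r ^ 4 * v"
      using n by (simp add: power_divide power_mult_distrib flip: power_mult)
    finally show ?thesis using r by (simp add: zero_le_mult_iff)
  qed
  have "r / c = 4 * r ^ 3 / n"
    using n r by (simp add: c_def power3_eq_cube power2_eq_square)
  moreover have "r ^ 5 = r ^ 3 * r\<^sup>2" by (simp flip: power_add)
  ultimately have "r / c * (4 * r\<^sup>2 * sqrt v + 2 * \<beta> * n * L2_set \<pi> A) =
      16 * r ^ 5 * (sqrt v / n) + 8 * r ^ 3 * \<beta> * L2_set \<pi> A"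
    using n by (simp add: distrib_left)
  also have "sqrt v / n = sqrt (v / n) * (1 / sqrt n)"
    using n by (simp add: real_sqrt_divide)
  also have "\<dots> \<le> sqrt (v / n) * L2_set \<pi> A"
    using L1 n \<open>v \<ge> 0\<close> by (intro mult_left_mono) (auto simp: field_simps)
  finally have "L2_set D A \<le> 16 * r ^ 5 * (sqrt (v / n) * L2_set \<pi> A) + 8 * r ^ 3 * \<beta> * L2_set \<pi> A"
    using D_le r by (simp add: mult_left_mono)
  hence "L2_set D A / L2_set \<pi> A \<le> 16 * r ^ 5 * sqrt (v / n) + 8 * r ^ 3 * \<beta>"
    using Lpos by (simp add: pos_divide_le_eq distrib_right mult.assoc)
  hence "L2_set (\<lambda>i. q i - \<pi> i) A / L2_set \<pi> A \<le> 16 * r ^ 5 * sqrt (v / n) + 8 * r ^ 3 * \<beta>"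
    by (simp only: D_def[abs_def])
  with q uniq show ?thesis by blast
qed

section \<open>Concentration for independent coins\<close>

lemma hoeffding_bernoulli_mgf:
  fixes c p :: real
  assumes p: "p \<in> {0..1}"
  shows "measure_pmf.expectation (bernoulli_pmf p) (\<lambda>x. exp (c * (of_bool x - p))) \<le> exp (c\<^sup>2 / 8)"
proof -
  have *: "q * exp (h * (1 - q)) + (1 - q) * exp (- (h * q)) \<le> exp (h\<^sup>2 / 8)"
    if "h \<ge> 0" "q \<in> {0..1}" for h q :: real
  proof -
    have pos: "1 + q * (exp h - 1) > 0"
      using that by (smt (verit) atLeastAtMost_iff exp_ge_zero mult_nonneg_nonneg one_le_exp_iff)
    have "q * exp (h * (1 - q)) + (1 - q) * exp (- (h * q)) = exp (- h * q) * (1 + q * (exp h - 1))"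
      by (simp add: algebra_simps flip: exp_add exp_diff)
    also have "\<dots> = exp (- h * q + ln (1 + q * (exp h - 1)))"
      using pos by (simp only: exp_add exp_ln)
    also have "\<dots> \<le> exp (h\<^sup>2 / 8)"
      using Hoeffdings_lemma_aux[of h q] that by simp
    finally show ?thesis .
  qed
  have "measure_pmf.expectation (bernoulli_pmf p) (\<lambda>x. exp (c * (of_bool x - p))) =
      p * exp (c * (1 - p)) + (1 - p) * exp (- (c * p))"
    using p by (simp add: integral_bernoulli_pmf)
  \<comment> \<open>A negative \<open>c\<close> is reduced to a positive one by exchanging the two
    outcomes of the coin.\<close>
  also have "\<dots> \<le> exp (c\<^sup>2 / 8)"
    using *[of c p] *[of "- c" "1 - p"] p by (cases "c \<ge> 0") (simp_all add: algebra_simps)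
  finally show ?thesis .
qed

lemma finite_set_Pi_pmf:
  assumes "finite I" "\<And>i. i \<in> I \<Longrightarrow> finite (set_pmf (M i))"
  shows "finite (set_pmf (Pi_pmf I dflt M))"
  using assms by (simp add: set_Pi_pmf finite_PiE_dflt)

lemma bernoulli_sum_mgf:
  fixes c p :: "'a \<Rightarrow> real"
  assumes I: "finite I" and p: "\<And>i. i \<in> I \<Longrightarrow> p i \<in> {0..1}"
  shows "measure_pmf.expectation (Pi_pmf I False (\<lambda>i. bernoulli_pmf (p i)))
           (\<lambda>z. exp (\<Sum>i\<in>I. c i * (of_bool (z i) - p i))) \<le> exp ((\<Sum>i\<in>I. (c i)\<^sup>2) / 8)"
proof -
  have "measure_pmf.expectation (Pi_pmf I False (\<lambda>i. bernoulli_pmf (p i)))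
           (\<lambda>z. exp (\<Sum>i\<in>I. c i * (of_bool (z i) - p i))) =
        measure_pmf.expectation (Pi_pmf I False (\<lambda>i. bernoulli_pmf (p i)))
           (\<lambda>z. \<Prod>i\<in>I. exp (c i * (of_bool (z i) - p i)))"
    using I by (simp add: exp_sum)
  also have "\<dots> = (\<Prod>i\<in>I. measure_pmf.expectation (bernoulli_pmf (p i)) (\<lambda>x. exp (c i * (of_bool x - p i))))"
    by (rule expectation_prod_Pi_pmf) (use I in \<open>auto intro: integrable_measure_pmf_finite\<close>)
  also have "\<dots> \<le> (\<Prod>i\<in>I. exp ((c i)\<^sup>2 / 8))"
    by (intro prod_mono conjI hoeffding_bernoulli_mgf p Bochner_Integration.integral_nonneg) auto
  also have "\<dots> = exp ((\<Sum>i\<in>I. (c i)\<^sup>2) / 8)"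
    using I by (simp add: exp_sum sum_divide_distrib)
  finally show ?thesis .
qed

lemma pmf_exp_Markov:
  fixes S :: "'a \<Rightarrow> real"
  assumes "finite (set_pmf M)" "measure_pmf.expectation M (\<lambda>x. exp (S x)) \<le> B"
  shows "measure_pmf.prob M {x. S x \<ge> \<tau>} \<le> B * exp (- \<tau>)"
proof -
  have "measure_pmf.prob M {x \<in> space M. exp (S x) \<ge> exp \<tau>} \<le> measure_pmf.expectation M (\<lambda>x. exp (S x)) / exp \<tau>"
    by (rule integral_Markov_inequality_measure[where A = "{}"])
       (use assms in \<open>auto intro: integrable_measure_pmf_finite\<close>)
  also have "\<dots> \<le> B / exp \<tau>" using assms by (intro divide_right_mono) auto
  finally show ?thesis by (simp add: exp_minus field_simps)
qed

lemma bernoulli_sum_tail: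
  fixes c p :: "'a \<Rightarrow> real"
  assumes I: "finite I" and p: "\<And>i. i \<in> I \<Longrightarrow> p i \<in> {0..1}"
    and V: "V > 0" "(\<Sum>i\<in>I. (c i)\<^sup>2) \<le> V" and \<tau>: "\<tau> \<ge> 0"
  shows "measure_pmf.prob (Pi_pmf I False (\<lambda>i. bernoulli_pmf (p i)))
           {z. \<bar>\<Sum>i\<in>I. c i * (of_bool (z i) - p i)\<bar> \<ge> \<tau>} \<le> 2 * exp (- 2 * \<tau>\<^sup>2 / V)"
proof -
  define M where "M = Pi_pmf I False (\<lambda>i. bernoulli_pmf (p i))"
  have fin: "finite (set_pmf M)" unfolding M_def using I by (intro finite_set_Pi_pmf) auto
  have *: "measure_pmf.prob M {z. (\<Sum>i\<in>I. a i * (of_bool (z i) - p i)) \<ge> \<tau>} \<le> exp (- 2 * \<tau>\<^sup>2 / V)"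
    if a: "(\<Sum>i\<in>I. (a i)\<^sup>2) \<le> V" for a
  proof (cases "\<tau> = 0")
    case False
    \<comment> \<open>The minimizer of the Chernoff exponent
      \<open>s^2 * V / 8 - s * \<tau>\<close>.\<close>
    define s where "s = 4 * \<tau> / V"
    have s: "s > 0" using False \<tau> V by (simp add: s_def)
    have "measure_pmf.expectation M (\<lambda>z. exp (\<Sum>i\<in>I. (s * a i) * (of_bool (z i) - p i)))
        \<le> exp ((\<Sum>i\<in>I. (s * a i)\<^sup>2) / 8)"
      unfolding M_def by (rule bernoulli_sum_mgf[OF I p])
    also have "(\<Sum>i\<in>I. (s * a i)\<^sup>2) = s\<^sup>2 * (\<Sum>i\<in>I. (a i)\<^sup>2)"
      by (simp add: power_mult_distrib sum_distrib_left)
    also have "exp (s\<^sup>2 * (\<Sum>i\<in>I. (a i)\<^sup>2) / 8) \<le> exp (s\<^sup>2 * V / 8)"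
      using a by (simp add: mult_left_mono)
    finally have "measure_pmf.prob M {z. (\<Sum>i\<in>I. (s * a i) * (of_bool (z i) - p i)) \<ge> s * \<tau>}
        \<le> exp (s\<^sup>2 * V / 8) * exp (- (s * \<tau>))"
      by (rule pmf_exp_Markov[OF fin])
    also have "exp (s\<^sup>2 * V / 8) * exp (- (s * \<tau>)) = exp (- 2 * \<tau>\<^sup>2 / V)"
    proof -
      have "s\<^sup>2 * V / 8 - s * \<tau> = - 2 * \<tau>\<^sup>2 / V"
        using V by (simp add: s_def power2_eq_square)
      thus ?thesis by (metis exp_add diff_conv_add_uminus)
    qed
    also have "{z. (\<Sum>i\<in>I. (s * a i) * (of_bool (z i) - p i)) \<ge> s * \<tau>} =
        {z. (\<Sum>i\<in>I. a i * (of_bool (z i) - p i)) \<ge> \<tau>}"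
      using s by (simp add: mult.assoc flip: sum_distrib_left)
    finally show ?thesis .
  qed simp
  have "measure_pmf.prob M {z. \<bar>\<Sum>i\<in>I. c i * (of_bool (z i) - p i)\<bar> \<ge> \<tau>} \<le>
     measure_pmf.prob M ({z. (\<Sum>i\<in>I. c i * (of_bool (z i) - p i)) \<ge> \<tau>} \<union>
       {z. (\<Sum>i\<in>I. (- c i) * (of_bool (z i) - p i)) \<ge> \<tau>})"
    by (intro measure_pmf.finite_measure_mono) (auto simp: sum_negf)
  also have "\<dots> \<le> exp (- 2 * \<tau>\<^sup>2 / V) + exp (- 2 * \<tau>\<^sup>2 / V)"
    by (rule order_trans[OF measure_Un_le])
       (use *[of c] *[of "\<lambda>i. - c i"] V in \<open>auto intro!: add_mono simp del: minus_mult_minus\<close>)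
  finally show ?thesis by (simp add: M_def)
qed

text \<open>Conditioning in two stages: \<open>B\<close> collects the exceptional results of the
  first stage, and the second stage is controlled only outside \<open>B\<close>.\<close>

lemma prob_bind_pmf_le:
  assumes "\<And>x. x \<in> set_pmf M \<Longrightarrow> x \<notin> B \<Longrightarrow> measure_pmf.prob (f x) S \<le> \<epsilon>" and "\<epsilon> \<ge> 0"
  shows "measure_pmf.prob (bind_pmf M f) S \<le> measure_pmf.prob M B + \<epsilon>"
proof -
  have "measure_pmf.prob (bind_pmf M f) S = measure_pmf.expectation M (\<lambda>x. measure_pmf.prob (f x) S)"
    unfolding measure_pmf_bind
    by (rule measure_pmf.measure_bind[where N = "count_space UNIV"])
       (auto intro: measure_pmf_in_subprob_algebra)
  also have "\<dots> \<le> measure_pmf.expectation M (\<lambda>x. indicator B x + \<epsilon>)"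
  proof (rule integral_mono_AE)
    show "integrable (measure_pmf M) (\<lambda>x. measure_pmf.prob (f x) S)"
      by (rule measure_pmf.integrable_const_bound[where B = 1]) auto
    show "AE x in measure_pmf M. measure_pmf.prob (f x) S \<le> indicator B x + \<epsilon>"
      unfolding AE_measure_pmf_iff
    proof
      fix x assume "x \<in> set_pmf M"
      thus "measure_pmf.prob (f x) S \<le> indicator B x + \<epsilon>"
        using assms measure_pmf.prob_le_1[of "f x" S] by (cases "x \<in> B") (auto intro: order_trans)
    qed
    show "integrable (measure_pmf M) (\<lambda>x. indicator B x + \<epsilon>)"
      using assms(2) by (intro measure_pmf.integrable_const_bound[where B = "1 + \<epsilon>"]) (auto simp: indicator_def)
  qed
  also have "\<dots> = measure_pmf.prob M B + \<epsilon>"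
    by (subst Bochner_Integration.integral_add) (auto simp: measure_pmf.emeasure_eq_measure)
  finally show ?thesis .
qed

text \<open>The coefficients depend only on the coins outside \<open>B\<close>. Freezing those coins
  splits the product law, and Hoeffding's inequality applies to the coins in \<open>B\<close>. The
  variance constraint sits inside the event because the coefficients are themselves random.\<close>

lemma bernoulli_sum_tail_conditional:
  fixes p :: "'a \<Rightarrow> real" and c :: "('a \<Rightarrow> bool) \<Rightarrow> 'a \<Rightarrow> real"
  assumes I: "finite I" "B \<subseteq> I" and p: "\<And>i. i \<in> I \<Longrightarrow> p i \<in> {0..1}"
    and c: "\<And>z z' i. (\<And>j. j \<in> I - B \<Longrightarrow> z j = z' j) \<Longrightarrow> i \<in> B \<Longrightarrow> c z i = c z' i"
    and V: "V > 0" and \<tau>: "\<tau> \<ge> 0"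
  shows "measure_pmf.prob (Pi_pmf I False (\<lambda>i. bernoulli_pmf (p i)))
           {z. (\<Sum>i\<in>B. (c z i)\<^sup>2) \<le> V \<and> \<bar>\<Sum>i\<in>B. c z i * (of_bool (z i) - p i)\<bar> \<ge> \<tau>} \<le> 2 * exp (- 2 * \<tau>\<^sup>2 / V)"
proof -
  define A where "A = I - B"
  have AB: "finite A" "finite B" "A \<inter> B = {}" "A \<union> B = I"
    using I by (auto simp: A_def finite_subset)
  define m :: "('a \<Rightarrow> bool) \<Rightarrow> ('a \<Rightarrow> bool) \<Rightarrow> 'a \<Rightarrow> bool"
    where "m x y = (\<lambda>i. if i \<in> A then x i else y i)" for x y
  define Q where "Q z \<longleftrightarrow> (\<Sum>i\<in>B. (c z i)\<^sup>2) \<le> V \<and> \<bar>\<Sum>i\<in>B. c z i * (of_bool (z i) - p i)\<bar> \<ge> \<tau>" for z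
  have Qm: "Q (m x y) \<longleftrightarrow> (\<Sum>i\<in>B. (c x i)\<^sup>2) \<le> V \<and> \<bar>\<Sum>i\<in>B. c x i * (of_bool (y i) - p i)\<bar> \<ge> \<tau>" for x y
  proof -
    have "c (m x y) i = c x i" if "i \<in> B" for i
      using that by (intro c) (auto simp: m_def A_def)
    moreover have "m x y i = y i" if "i \<in> B" for i using that AB by (auto simp: m_def)
    ultimately show ?thesis by (simp add: Q_def cong: sum.cong)
  qed
  have "measure_pmf.prob (Pi_pmf I False (\<lambda>i. bernoulli_pmf (p i))) {z. Q z} =
    measure_pmf.prob (pair_pmf (Pi_pmf A False (\<lambda>i. bernoulli_pmf (p i))) (Pi_pmf B False (\<lambda>i. bernoulli_pmf (p i))))
      {(x, y). Q (m x y)}"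
    unfolding AB(4)[symmetric] by (subst Pi_pmf_union[OF AB(1-3)]) (simp add: m_def case_prod_unfold vimage_def)
  also have "\<dots> \<le> 2 * exp (- 2 * \<tau>\<^sup>2 / V)"
  proof -
    have inner: "measure_pmf.prob (Pi_pmf B False (\<lambda>i. bernoulli_pmf (p i))) {y. Q (m x y)} \<le> 2 * exp (- 2 * \<tau>\<^sup>2 / V)" for x
    proof (cases "(\<Sum>i\<in>B. (c x i)\<^sup>2) \<le> V")
      case True
      thus ?thesis unfolding Qm using bernoulli_sum_tail[OF AB(2) _ V True \<tau>, of p] p I(2) by auto
    qed (simp add: Qm)
    show ?thesis
      unfolding pair_pmf_def
      by (rule order_trans[OF prob_bind_pmf_le[where B = "{}" and \<epsilon> = "2 * exp (- 2 * \<tau>\<^sup>2 / V)"]])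
         (use inner in \<open>auto simp: vimage_def simp flip: map_pmf_def\<close>)
  qed
  finally show ?thesis by (simp add: Q_def)
qed

section \<open>Exponential moments of sums of squares via Gaussian integrals\<close>

lemma integral_exp_std_normal:
  fixes a :: real
  shows "integrable lborel (\<lambda>g. exp (a * g) * std_normal_density g)"
    and "(\<integral>g. exp (a * g) * std_normal_density g \<partial>lborel) = exp (a\<^sup>2 / 2)"
proof -
  have eq: "exp (a * g) * std_normal_density g = exp (a\<^sup>2 / 2) * normal_density a 1 g" for g
  proof -
    have "a * g + - g\<^sup>2 / 2 = a\<^sup>2 / 2 + - (g - a)\<^sup>2 / 2"
      by (simp add: power2_eq_square field_simps)
    hence "exp (a * g) * exp (- g\<^sup>2 / 2) = exp (a\<^sup>2 / 2) * exp (- (g - a)\<^sup>2 / 2)"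
      by (metis exp_add)
    thus ?thesis by (simp add: normal_density_def)
  qed
  show "integrable lborel (\<lambda>g. exp (a * g) * std_normal_density g)"
    unfolding eq by (intro integrable_mult_right) simp
  show "(\<integral>g. exp (a * g) * std_normal_density g \<partial>lborel) = exp (a\<^sup>2 / 2)"
    unfolding eq by simp
qed

lemma integral_exp_square_std_normal:
  shows "integrable lborel (\<lambda>g. exp (g\<^sup>2 / 4) * std_normal_density g)"
    and "(\<integral>g. exp (g\<^sup>2 / 4) * std_normal_density g \<partial>lborel) = sqrt 2"
proof -
  have eq: "exp (g\<^sup>2 / 4) * std_normal_density g = sqrt 2 * normal_density 0 (sqrt 2) g" for g
  proof -
    have "g\<^sup>2 / 4 + - g\<^sup>2 / 2 = - g\<^sup>2 / 4" by simp
    hence "exp (g\<^sup>2 / 4) * exp (- g\<^sup>2 / 2) = exp (- g\<^sup>2 / 4)" by (metis exp_add)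
    moreover have "1 / sqrt (2 * pi * 1\<^sup>2) = sqrt 2 * (1 / sqrt (2 * pi * (sqrt 2)\<^sup>2))"
    proof -
      have "sqrt (2 * pi * (sqrt 2)\<^sup>2) = sqrt 2 * sqrt (2 * pi)"
        by (simp add: real_sqrt_mult)
      thus ?thesis by simp
    qed
    ultimately show ?thesis by (simp add: normal_density_def)
  qed
  show "integrable lborel (\<lambda>g. exp (g\<^sup>2 / 4) * std_normal_density g)"
    unfolding eq by (intro integrable_mult_right) simp
  show "(\<integral>g. exp (g\<^sup>2 / 4) * std_normal_density g \<partial>lborel) = sqrt 2"
    unfolding eq by simp
qed

text \<open>The square in the exponent is written as a Gaussian average of linear exponentials, the
  two expectations are exchanged, and the bound on linear combinations is applied for each fixed
  \<open>g\<close>. The coordinates of \<open>R\<close> may be dependent. Finite support of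
  \<open>M\<close> makes the exchange a finite sum of integrals.\<close>

lemma subgaussian_square_mgf:
  fixes R :: "'a \<Rightarrow> 'j \<Rightarrow> real"
  assumes M: "finite (set_pmf M)" and J: "finite J" and V: "V > 0"
    and mgf: "\<And>g. measure_pmf.expectation M (\<lambda>x. exp (\<Sum>j\<in>J. g j * R x j)) \<le> exp (V / 2 * (\<Sum>j\<in>J. (g j)\<^sup>2))"
  shows "measure_pmf.expectation M (\<lambda>x. exp ((\<Sum>j\<in>J. (R x j)\<^sup>2) / (4 * V))) \<le> sqrt 2 ^ card J"
proof -
  interpret product_sigma_finite "\<lambda>_::'j. lborel :: real measure" ..
  define G where "G = Pi\<^sub>M J (\<lambda>_. lborel :: real measure)"
  \<comment> \<open>With this scale \<open>(s * R)^2 / 2 = R^2 / (4 * V)\<close> on one side, and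
    \<open>V / 2 * (s * g)^2 = g^2 / 4\<close> on the other, which is integrable against the
    Gaussian density and gives \<open>sqrt 2\<close> per coordinate.\<close>
  define s where "s = 1 / sqrt (2 * V)"
  have s2: "s\<^sup>2 = 1 / (2 * V)" using V by (simp add: s_def power_divide)
  define h where "h g = (\<Prod>j\<in>J. std_normal_density (g j))" for g
  have h0: "h g \<ge> 0" for g by (simp add: h_def prod_nonneg)
  have lin: "exp (\<Sum>j\<in>J. (s * g j) * R x j) * h g = (\<Prod>j\<in>J. exp ((s * R x j) * g j) * std_normal_density (g j))" for x g
    using J by (simp add: h_def exp_sum prod.distrib mult_ac)
  have int: "integrable G (\<lambda>g. exp (\<Sum>j\<in>J. (s * g j) * R x j) * h g)" for x
    unfolding lin G_def using J by (intro product_integrable_prod integral_exp_std_normal)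
  have sq: "exp ((\<Sum>j\<in>J. (R x j)\<^sup>2) / (4 * V)) = (\<integral>g. exp (\<Sum>j\<in>J. (s * g j) * R x j) * h g \<partial>G)" for x
  proof -
    have "(\<integral>g. exp (\<Sum>j\<in>J. (s * g j) * R x j) * h g \<partial>G) = (\<Prod>j\<in>J. exp ((s * R x j)\<^sup>2 / 2))"
      unfolding lin G_def using J
      by (subst product_integral_prod) (auto intro!: integral_exp_std_normal prod.cong)
    also have "\<dots> = exp (\<Sum>j\<in>J. (R x j)\<^sup>2 / (4 * V))"
      using J by (simp add: exp_sum power_mult_distrib s2)
    finally show ?thesis by (simp add: sum_divide_distrib)
  qed
  have qlin: "exp (V / 2 * (\<Sum>j\<in>J. (s * g j)\<^sup>2)) * h g = (\<Prod>j\<in>J. exp ((g j)\<^sup>2 / 4) * std_normal_density (g j))" for g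
  proof -
    have "V / 2 * (\<Sum>j\<in>J. (s * g j)\<^sup>2) = (\<Sum>j\<in>J. (g j)\<^sup>2 / 4)"
      unfolding sum_distrib_left using V by (intro sum.cong) (simp_all add: power_mult_distrib s2)
    thus ?thesis using J by (simp add: h_def exp_sum prod.distrib)
  qed
  have "measure_pmf.expectation M (\<lambda>x. exp ((\<Sum>j\<in>J. (R x j)\<^sup>2) / (4 * V))) =
      (\<Sum>x\<in>set_pmf M. pmf M x * (\<integral>g. exp (\<Sum>j\<in>J. (s * g j) * R x j) * h g \<partial>G))"
    unfolding sq using M by (subst integral_measure_pmf_real[of "set_pmf M"]) (auto simp: mult.commute)
  also have "\<dots> = (\<integral>g. (\<Sum>x\<in>set_pmf M. pmf M x * (exp (\<Sum>j\<in>J. (s * g j) * R x j) * h g)) \<partial>G)"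
    using int by (subst Bochner_Integration.integral_sum) auto
  also have "\<dots> \<le> (\<integral>g. exp (V / 2 * (\<Sum>j\<in>J. (s * g j)\<^sup>2)) * h g \<partial>G)"
  proof (rule integral_mono)
    show "integrable G (\<lambda>g. \<Sum>x\<in>set_pmf M. pmf M x * (exp (\<Sum>j\<in>J. s * g j * R x j) * h g))"
      using int by (intro Bochner_Integration.integrable_sum integrable_mult_right)
    show "integrable G (\<lambda>g. exp (V / 2 * (\<Sum>j\<in>J. (s * g j)\<^sup>2)) * h g)"
      unfolding qlin G_def using J by (intro product_integrable_prod integral_exp_square_std_normal)
    fix g
    have "(\<Sum>x\<in>set_pmf M. pmf M x * (exp (\<Sum>j\<in>J. s * g j * R x j) * h g)) =
        measure_pmf.expectation M (\<lambda>x. exp (\<Sum>j\<in>J. (s * g j) * R x j)) * h g"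
      using M by (subst integral_measure_pmf_real[of "set_pmf M"]) (auto simp: mult_ac sum_distrib_left)
    also have "\<dots> \<le> exp (V / 2 * (\<Sum>j\<in>J. (s * g j)\<^sup>2)) * h g"
      by (rule mult_right_mono[OF mgf h0])
    finally show "(\<Sum>x\<in>set_pmf M. pmf M x * (exp (\<Sum>j\<in>J. s * g j * R x j) * h g))
        \<le> exp (V / 2 * (\<Sum>j\<in>J. (s * g j)\<^sup>2)) * h g" .
  qed
  also have "\<dots> = sqrt 2 ^ card J"
    unfolding qlin G_def using J
    by (subst product_integral_prod) (auto simp: integral_exp_square_std_normal)
  finally show ?thesis .
qed

section \<open>Antisymmetric random matrices\<close>

lemma sum_pairs_less:
  fixes F :: "nat \<Rightarrow> nat \<Rightarrow> real"
  assumes A: "finite A" and F: "\<And>i. i \<in> A \<Longrightarrow> F i i = 0"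
  shows "(\<Sum>i\<in>A. \<Sum>j\<in>A. F i j) = (\<Sum>(i, j)\<in>{(i, j) \<in> A \<times> A. i < j}. F i j + F j i)"
proof -
  define U where "U = {(i, j) \<in> A \<times> A. i < j}"
  have U: "finite U" "finite (prod.swap ` U)" "U \<inter> prod.swap ` U = {}" "U \<union> prod.swap ` U \<subseteq> A \<times> A"
    using A by (auto simp: U_def intro: finite_subset[of _ "A \<times> A"])
  have "(\<Sum>i\<in>A. \<Sum>j\<in>A. F i j) = (\<Sum>(i, j)\<in>A \<times> A. F i j)"
    by (simp add: sum.cartesian_product)
  also have "\<dots> = (\<Sum>(i, j)\<in>U \<union> prod.swap ` U. F i j)"
  proof (rule sum.mono_neutral_right)
    show "\<forall>x\<in>A \<times> A - (U \<union> prod.swap ` U). (case x of (i, j) \<Rightarrow> F i j) = 0"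
    proof
      fix x assume x: "x \<in> A \<times> A - (U \<union> prod.swap ` U)"
      obtain i j where x_eq: "x = (i, j)" by (rule prod.exhaust)
      have ij: "i \<in> A" "j \<in> A" "(i, j) \<notin> U \<union> prod.swap ` U" using x by (auto simp: x_eq)
      have "(i, j) \<in> prod.swap ` U \<longleftrightarrow> (j, i) \<in> U" by (metis image_iff swap_simp swap_swap)
      hence "i = j" using ij by (auto simp: U_def)
      thus "(case x of (i, j) \<Rightarrow> F i j) = 0" using F ij by (simp add: x_eq)
    qed
  qed (use A U in auto)
  also have "\<dots> = (\<Sum>(i, j)\<in>U. F i j) + (\<Sum>(i, j)\<in>prod.swap ` U. F i j)"
    using U by (intro sum.union_disjoint)
  also have "(\<Sum>(i, j)\<in>prod.swap ` U. F i j) = (\<Sum>(i, j)\<in>U. F j i)"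
    by (subst sum.reindex) (auto simp: inj_on_def case_prod_unfold)
  finally show ?thesis by (simp add: U_def sum.distrib case_prod_unfold)
qed

text \<open>\<open>A\<close> indexes rows and columns, \<open>I\<close> the coins, and
  \<open>blk i j\<close> the coins that enter entry \<open>(i, j)\<close>. \<open>I\<close> may
  contain coins of no block, such as comparisons at times outside the neighborhood. The single
  number \<open>v\<close> bounds the reciprocals of all block sizes, so that random block sizes are
  replaced by one deterministic variance level.\<close>

locale bernoulli_matrix =
  fixes A :: "nat set" and I :: "'o set" and blk :: "nat \<Rightarrow> nat \<Rightarrow> 'o set" and p :: "'o \<Rightarrow> real" and v :: real
  assumes finA: "finite A" and finI: "finite I"
    and p01: "\<And>x. x \<in> I \<Longrightarrow> p x \<in> {0..1}"
    and blk_sym: "\<And>i j. blk i j = blk j i"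
    and blk_subset: "\<And>i j. i \<in> A \<Longrightarrow> j \<in> A \<Longrightarrow> i \<noteq> j \<Longrightarrow> blk i j \<subseteq> I"
    and blk_disjoint: "\<And>i j k l x. i \<noteq> j \<Longrightarrow> x \<in> blk i j \<Longrightarrow> x \<in> blk k l \<Longrightarrow> {i, j} = {k, l}"
    and v_pos: "v > 0"
    and blk_card: "\<And>i j. i \<in> A \<Longrightarrow> j \<in> A \<Longrightarrow> i \<noteq> j \<Longrightarrow> 1 \<le> v * card (blk i j)"
begin

text \<open>Both orientations of a pair read the same coins; the sign makes the resulting matrix
  \<open>X\<close> antisymmetric.\<close>

definition coef :: "nat \<Rightarrow> nat \<Rightarrow> 'o \<Rightarrow> real" where
  "coef i j x = (if i \<noteq> j \<and> x \<in> blk i j then (if i < j then 1 else -1) / card (blk i j) else 0)"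

definition X :: "('o \<Rightarrow> bool) \<Rightarrow> nat \<Rightarrow> nat \<Rightarrow> real" where
  "X z i j = (\<Sum>x\<in>I. coef i j x * (of_bool (z x) - p x))"

abbreviation coins :: "('o \<Rightarrow> bool) pmf" where
  "coins \<equiv> Pi_pmf I False (\<lambda>x. bernoulli_pmf (p x))"

lemma coef_antisym: "coef i j x = - coef j i x"
  by (auto simp: coef_def blk_sym)

lemma X_antisym: "X z i j = - X z j i"
  unfolding X_def by (subst coef_antisym) (simp add: sum_negf)

lemma X_diag [simp]: "X z i i = 0"
  by (simp add: X_def coef_def)

lemma finite_set_coins: "finite (set_pmf coins)"
  using finI by (intro finite_set_Pi_pmf) auto

lemma coef_square_sum:
  assumes "i \<in> A" "j \<in> A" "i \<noteq> j"
  shows "(\<Sum>x\<in>I. (coef i j x)\<^sup>2) \<le> v"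
proof -
  have pos: "card (blk i j) > 0" using blk_card[OF assms] by (cases "card (blk i j)") auto
  have "(\<Sum>x\<in>I. (coef i j x)\<^sup>2) = (\<Sum>x\<in>blk i j. 1 / (real (card (blk i j)))\<^sup>2)"
    using blk_subset[OF assms] finI assms(3)
    by (intro sum.mono_neutral_cong_right) (auto simp: coef_def power_divide)
  also have "\<dots> = 1 / real (card (blk i j))" using pos by (simp add: power2_eq_square)
  also have "\<dots> \<le> v" using blk_card[OF assms] pos by (simp add: field_simps)
  finally show ?thesis .
qed

text \<open>Distinct unordered pairs have disjoint blocks, so their coefficient vectors are
  orthogonal and the cross terms vanish. The hypothesis \<open>asym\<close> excludes both
  orientations of one pair, which would be parallel instead.\<close>

lemma coef_combination_square_sum:
  assumes S: "S \<subseteq> A \<times> A" and asym: "\<And>i j. (i, j) \<in> S \<Longrightarrow> (j, i) \<notin> S"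
  shows "(\<Sum>x\<in>I. (\<Sum>(i, j)\<in>S. h i j * coef i j x)\<^sup>2) \<le> v * (\<Sum>(i, j)\<in>S. (h i j)\<^sup>2)"
proof -
  have fS: "finite S" using S finA by (auto intro: finite_subset)
  define f where "f s x = (case s of (i, j) \<Rightarrow> h i j * coef i j x)" for s x
  have orth: "f s x * f s' x = (if s = s' then (f s x)\<^sup>2 else 0)" if "s \<in> S" "s' \<in> S" for s s' x
  proof (cases "s = s' \<or> f s x = 0 \<or> f s' x = 0")
    case False
    obtain i j k l where s: "s = (i, j)" "s' = (k, l)" by (metis surj_pair)
    from False have "coef i j x \<noteq> 0" "coef k l x \<noteq> 0" by (auto simp: f_def s)
    hence "i \<noteq> j" "x \<in> blk i j" "x \<in> blk k l" by (auto simp: coef_def split: if_splits)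
    hence "{i, j} = {k, l}" by (rule blk_disjoint)
    hence "(i, j) = (k, l) \<or> (j, i) = (k, l)" by (auto simp: doubleton_eq_iff)
    thus ?thesis using that asym False by (auto simp: s)
  qed (auto simp: power2_eq_square)
  have "(\<Sum>x\<in>I. (\<Sum>(i, j)\<in>S. h i j * coef i j x)\<^sup>2) = (\<Sum>x\<in>I. \<Sum>s\<in>S. \<Sum>s'\<in>S. f s x * f s' x)"
    by (simp add: power2_eq_square sum_product f_def case_prod_unfold)
  also have "\<dots> = (\<Sum>x\<in>I. \<Sum>s\<in>S. (f s x)\<^sup>2)"
    using fS by (intro sum.cong refl) (simp add: orth cong: sum.cong)
  also have "\<dots> = (\<Sum>s\<in>S. \<Sum>x\<in>I. (f s x)\<^sup>2)" by (rule sum.swap)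
  also have "\<dots> \<le> (\<Sum>(i, j)\<in>S. (h i j)\<^sup>2 * v)"
  proof (intro sum_mono)
    fix s assume s: "s \<in> S"
    obtain i j where ij: "s = (i, j)" by (metis surj_pair)
    have "(\<Sum>x\<in>I. (f s x)\<^sup>2) = (h i j)\<^sup>2 * (\<Sum>x\<in>I. (coef i j x)\<^sup>2)"
      by (simp add: f_def ij power_mult_distrib sum_distrib_left)
    also have "\<dots> \<le> (h i j)\<^sup>2 * v"
      using s S asym[of i j] unfolding ij by (intro mult_left_mono coef_square_sum) auto
    finally show "(\<Sum>x\<in>I. (f s x)\<^sup>2) \<le> (case s of (i, j) \<Rightarrow> (h i j)\<^sup>2 * v)" by (simp add: ij)
  qed
  also have "\<dots> = v * (\<Sum>(i, j)\<in>S. (h i j)\<^sup>2)"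
    by (simp add: sum_distrib_left case_prod_unfold mult.commute)
  finally show ?thesis .
qed

lemma combination_eq:
  "(\<Sum>(i, j)\<in>S. h i j * X z i j) = (\<Sum>x\<in>I. (\<Sum>(i, j)\<in>S. h i j * coef i j x) * (of_bool (z x) - p x))"
  unfolding X_def case_prod_unfold sum_distrib_left sum_distrib_right
  by (rule trans[OF sum.swap]) (simp add: mult.assoc)

lemma combination_tail:
  assumes S: "S \<subseteq> A \<times> A" and asym: "\<And>i j. (i, j) \<in> S \<Longrightarrow> (j, i) \<notin> S"
    and H: "(\<Sum>(i, j)\<in>S. (h i j)\<^sup>2) \<le> H" "H > 0" and \<tau>: "\<tau> \<ge> 0"
  shows "measure_pmf.prob coins {z. \<bar>\<Sum>(i, j)\<in>S. h i j * X z i j\<bar> \<ge> \<tau>} \<le> 2 * exp (- 2 * \<tau>\<^sup>2 / (v * H))"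
  unfolding combination_eq
proof (rule bernoulli_sum_tail[OF finI p01 _ _ \<tau>])
  show "(\<Sum>x\<in>I. (\<Sum>(i, j)\<in>S. h i j * coef i j x)\<^sup>2) \<le> v * H"
    using coef_combination_square_sum[OF S asym, of h] mult_left_mono[OF H(1), of v] v_pos by linarith
qed (use v_pos H in auto)

text \<open>Rows \<open>i\<close> and \<open>k\<close> have only the entry of the pair
  \<open>{i, k}\<close> in common, and it drops out of their inner product because it meets a zero
  diagonal entry. Given the coins of row \<open>i\<close>, the product is therefore a linear
  combination of independent centered coins with coefficients read off from row \<open>i\<close>;
  the square norm of that row is the variance proxy.\<close>

lemma row_product_tail:
  assumes i: "i \<in> A" and k: "k \<in> A" "i \<noteq> k" and H: "H > 0" and \<tau>: "\<tau> \<ge> 0"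
  shows "measure_pmf.prob coins
    {z. (\<Sum>j\<in>A. (X z i j)\<^sup>2) \<le> H \<and> \<bar>\<Sum>j\<in>A. X z i j * X z k j\<bar> \<ge> \<tau>} \<le> 2 * exp (- 2 * \<tau>\<^sup>2 / (v * H))"
proof -
  \<comment> \<open>For \<open>j = i\<close> the factor \<open>X z i i\<close> is 0, for
    \<open>j = k\<close> the factor \<open>X z k k\<close>.\<close>
  define J where "J = A - {i, k}"
  \<comment> \<open>The coins outside row \<open>i\<close>, which stay random once row
    \<open>i\<close> is frozen.\<close>
  define B where "B = I - (\<Union>j\<in>A - {i}. blk i j)"
  define c where "c z x = (\<Sum>j\<in>J. X z i j * coef k j x)" for z x
  have c0: "c z x = 0" if x: "x \<in> I - B" for z x
  proof -
    obtain l where l: "l \<in> A" "l \<noteq> i" "x \<in> blk i l" using x by (auto simp: B_def)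
    have "coef k j x = 0" if j: "j \<in> J" for j
    proof (rule ccontr)
      assume "coef k j x \<noteq> 0"
      hence "k \<noteq> j" "x \<in> blk k j" by (auto simp: coef_def split: if_splits)
      hence "{k, j} = {i, l}" using blk_disjoint l(3) by blast
      thus False using j k by (auto simp: J_def doubleton_eq_iff)
    qed
    thus ?thesis by (simp add: c_def)
  qed
  have prod_eq: "(\<Sum>j\<in>A. X z i j * X z k j) = (\<Sum>x\<in>B. c z x * (of_bool (z x) - p x))" for z
  proof -
    have "(\<Sum>j\<in>A. X z i j * X z k j) = (\<Sum>j\<in>J. X z i j * X z k j)"
      using finA by (intro sum.mono_neutral_right) (auto simp: J_def)
    also have "\<dots> = (\<Sum>x\<in>I. c z x * (of_bool (z x) - p x))"
      unfolding c_def X_def[of z k] sum_distrib_left sum_distrib_right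
      by (rule trans[OF sum.swap]) (simp add: mult.assoc)
    also have "\<dots> = (\<Sum>x\<in>B. c z x * (of_bool (z x) - p x))"
      using finI c0 by (intro sum.mono_neutral_right) (auto simp: B_def)
    finally show ?thesis .
  qed
  have square_le: "(\<Sum>x\<in>B. (c z x)\<^sup>2) \<le> v * H" if "(\<Sum>j\<in>A. (X z i j)\<^sup>2) \<le> H" for z
  proof -
    have "(\<Sum>x\<in>B. (c z x)\<^sup>2) \<le> (\<Sum>x\<in>I. (c z x)\<^sup>2)"
      using finI by (intro sum_mono2) (auto simp: B_def)
    also have "\<dots> = (\<Sum>x\<in>I. (\<Sum>(l, j)\<in>{k} \<times> J. X z i j * coef l j x)\<^sup>2)"
      by (simp add: c_def flip: sum.cartesian_product)
    also have "\<dots> \<le> v * (\<Sum>(l, j)\<in>{k} \<times> J. (X z i j)\<^sup>2)"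
      by (rule coef_combination_square_sum) (use k in \<open>auto simp: J_def\<close>)
    also have "(\<Sum>(l, j)\<in>{k} \<times> J. (X z i j)\<^sup>2) = (\<Sum>j\<in>J. (X z i j)\<^sup>2)"
      by (simp flip: sum.cartesian_product)
    also have "\<dots> \<le> (\<Sum>j\<in>A. (X z i j)\<^sup>2)"
      using finA by (intro sum_mono2) (auto simp: J_def)
    finally show ?thesis using that v_pos by (meson mult_left_mono order_trans less_imp_le)
  qed
  have "measure_pmf.prob coins {z. (\<Sum>j\<in>A. (X z i j)\<^sup>2) \<le> H \<and> \<bar>\<Sum>j\<in>A. X z i j * X z k j\<bar> \<ge> \<tau>} \<le>
    measure_pmf.prob coins {z. (\<Sum>x\<in>B. (c z x)\<^sup>2) \<le> v * H \<and> \<bar>\<Sum>x\<in>B. c z x * (of_bool (z x) - p x)\<bar> \<ge> \<tau>}"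
    unfolding prod_eq using square_le by (intro measure_pmf.finite_measure_mono) auto
  also have "\<dots> \<le> 2 * exp (- 2 * \<tau>\<^sup>2 / (v * H))"
  proof (rule bernoulli_sum_tail_conditional[OF finI _ p01 _ _ \<tau>])
    fix z z' :: "'o \<Rightarrow> bool" and x
    assume eq: "\<And>y. y \<in> I - B \<Longrightarrow> z y = z' y"
    have "X z i j = X z' i j" if j: "j \<in> J" for j
      unfolding X_def
    proof (intro sum.cong refl)
      fix y assume y: "y \<in> I"
      show "coef i j y * (of_bool (z y) - p y) = coef i j y * (of_bool (z' y) - p y)"
      proof (cases "coef i j y = 0")
        case False
        hence "y \<in> blk i j" by (auto simp: coef_def split: if_splits)
        hence "y \<in> I - B" using y j by (auto simp: B_def J_def)
        thus ?thesis using eq by simp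
      qed simp
    qed
    thus "c z x = c z' x" by (simp add: c_def)
  qed (use v_pos H in \<open>auto simp: B_def\<close>)
  finally show ?thesis .
qed

text \<open>A combination of the row sums with weights \<open>g\<close> collapses, as \<alpha> is
  symmetric and \<open>X\<close> antisymmetric, to one term
  \<open>(g i - g j) * \<alpha> i j * X z i j\<close> per unordered pair. This is a sum over
  independent coins although the row sums are dependent, so the Gaussian linearization
  applies.\<close>

lemma weighted_row_sums_tail:
  assumes A: "A \<noteq> {}" and sym: "\<And>i j. \<alpha> i j = \<alpha> j i"
    and \<alpha>: "\<And>i j. i \<in> A \<Longrightarrow> j \<in> A \<Longrightarrow> \<bar>\<alpha> i j\<bar> \<le> a" and a: "a > 0"
  shows "measure_pmf.prob coins
    {z. (\<Sum>j\<in>A. (\<Sum>i\<in>A. \<alpha> j i * X z j i)\<^sup>2) \<ge> 4 * (real (card A))\<^sup>2 * v * a\<^sup>2} \<le> exp (- real (card A))"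
proof -
  define n where "n = real (card A)"
  have n: "n > 0" using A finA by (simp add: n_def card_gt_0_iff)
  define R where "R z j = (\<Sum>i\<in>A. \<alpha> j i * X z j i)" for z j
  \<comment> \<open>From \<open>(g i - g j)^2 \<le> 2 * (g i)^2 + 2 * (g j)^2\<close> the coin
    coefficients have square sum at most \<open>2 * v * a^2 * n\<close> times that of
    \<open>g\<close>; dividing by the 8 of Hoeffding's lemma yields \<open>V / 2\<close>.\<close>
  define V where "V = v * a\<^sup>2 * n / 2"
  have V: "V > 0" using v_pos a n by (simp add: V_def)
  define U where "U = {(i, j) \<in> A \<times> A. i < j}"
  have "measure_pmf.expectation coins (\<lambda>z. exp ((\<Sum>j\<in>A. (R z j)\<^sup>2) / (4 * V))) \<le> sqrt 2 ^ card A"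
  proof (rule subgaussian_square_mgf[OF finite_set_coins finA V])
    fix g :: "nat \<Rightarrow> real"
    have lin: "(\<Sum>j\<in>A. g j * R z j) = (\<Sum>(i, j)\<in>U. ((g i - g j) * \<alpha> i j) * X z i j)" for z
    proof -
      have "(\<Sum>j\<in>A. g j * R z j) = (\<Sum>j\<in>A. \<Sum>i\<in>A. g j * \<alpha> j i * X z j i)"
        by (simp add: R_def sum_distrib_left mult.assoc)
      also have "\<dots> = (\<Sum>(i, j)\<in>U. g i * \<alpha> i j * X z i j + g j * \<alpha> j i * X z j i)"
        unfolding U_def by (rule sum_pairs_less[OF finA]) simp
      also have "\<dots> = (\<Sum>(i, j)\<in>U. ((g i - g j) * \<alpha> i j) * X z i j)"
      proof (intro sum.cong refl, clarify)
        fix i j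
        show "g i * \<alpha> i j * X z i j + g j * \<alpha> j i * X z j i = ((g i - g j) * \<alpha> i j) * X z i j"
          using X_antisym[of z j i] sym[of j i] by (simp add: algebra_simps)
      qed
      finally show ?thesis .
    qed
    have "measure_pmf.expectation coins (\<lambda>z. exp (\<Sum>j\<in>A. g j * R z j)) \<le>
        exp ((\<Sum>x\<in>I. (\<Sum>(i, j)\<in>U. ((g i - g j) * \<alpha> i j) * coef i j x)\<^sup>2) / 8)"
      unfolding lin combination_eq by (rule bernoulli_sum_mgf[OF finI p01])
    also have "\<dots> \<le> exp (V / 2 * (\<Sum>j\<in>A. (g j)\<^sup>2))"
    proof -
      \<comment> \<open>The factors \<open>of_bool\<close> are 1 on \<open>U\<close>; they make the
        diagonal terms vanish, so that the sum over pairs can be unfolded into a full double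
        sum.\<close>
      have "(\<Sum>(i, j)\<in>U. ((g i - g j) * \<alpha> i j)\<^sup>2) \<le>
          (\<Sum>(i, j)\<in>U. 2 * a\<^sup>2 * (g i)\<^sup>2 * of_bool (i \<noteq> j) + 2 * a\<^sup>2 * (g j)\<^sup>2 * of_bool (j \<noteq> i))"
      proof (intro sum_mono, clarify)
        fix i j assume "(i, j) \<in> U"
        hence ij: "i \<in> A" "j \<in> A" "i \<noteq> j" by (auto simp: U_def)
        have "0 \<le> (g i + g j)\<^sup>2" by simp
        hence 1: "(g i - g j)\<^sup>2 \<le> 2 * (g i)\<^sup>2 + 2 * (g j)\<^sup>2" by (simp add: power2_eq_square algebra_simps)
        have 2: "(\<alpha> i j)\<^sup>2 \<le> a\<^sup>2" using \<alpha>[OF ij(1,2)] a by (simp add: abs_le_square_iff[symmetric])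
        have "((g i - g j) * \<alpha> i j)\<^sup>2 \<le> (2 * (g i)\<^sup>2 + 2 * (g j)\<^sup>2) * a\<^sup>2"
          unfolding power_mult_distrib using 1 2 by (intro mult_mono) auto
        thus "((g i - g j) * \<alpha> i j)\<^sup>2 \<le>
            2 * a\<^sup>2 * (g i)\<^sup>2 * of_bool (i \<noteq> j) + 2 * a\<^sup>2 * (g j)\<^sup>2 * of_bool (j \<noteq> i)"
          using ij by (simp add: algebra_simps)
      qed
      also have "\<dots> = (\<Sum>i\<in>A. \<Sum>j\<in>A. 2 * a\<^sup>2 * (g i)\<^sup>2 * of_bool (i \<noteq> j))"
        unfolding U_def by (rule sum_pairs_less[OF finA, symmetric]) simp
      also have "\<dots> \<le> (\<Sum>i\<in>A. \<Sum>j\<in>A. 2 * a\<^sup>2 * (g i)\<^sup>2)"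
        by (intro sum_mono) auto
      also have "\<dots> = 2 * a\<^sup>2 * n * (\<Sum>i\<in>A. (g i)\<^sup>2)"
        by (simp add: n_def sum_distrib_left mult_ac)
      finally have "v * (\<Sum>(i, j)\<in>U. ((g i - g j) * \<alpha> i j)\<^sup>2) \<le> v * (2 * a\<^sup>2 * n * (\<Sum>i\<in>A. (g i)\<^sup>2))"
        using v_pos by simp
      moreover have "(\<Sum>x\<in>I. (\<Sum>(i, j)\<in>U. ((g i - g j) * \<alpha> i j) * coef i j x)\<^sup>2) \<le>
          v * (\<Sum>(i, j)\<in>U. ((g i - g j) * \<alpha> i j)\<^sup>2)"
        by (rule coef_combination_square_sum) (auto simp: U_def)
      ultimately show ?thesis by (simp add: V_def)
    qed
    finally show "measure_pmf.expectation coins (\<lambda>z. exp (\<Sum>j\<in>A. g j * R z j)) \<le> exp (V / 2 * (\<Sum>j\<in>A. (g j)\<^sup>2))" .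
  qed
  \<comment> \<open>At level \<open>2 * n\<close> the moment bound \<open>sqrt 2 ^ n\<close>, at
    most \<open>exp n\<close>, still leaves \<open>exp (- n)\<close>; the level translates to
    \<open>8 * n * V = 4 * n^2 * v * a^2\<close>.\<close>
  hence "measure_pmf.prob coins {z. (\<Sum>j\<in>A. (R z j)\<^sup>2) / (4 * V) \<ge> 2 * n} \<le> sqrt 2 ^ card A * exp (- (2 * n))"
    by (rule pmf_exp_Markov[OF finite_set_coins])
  also have "sqrt 2 \<le> exp 1"
    using exp_ge_add_one_self[of 1] real_sqrt_le_iff[of 2 4] by simp
  hence "sqrt 2 ^ card A * exp (- (2 * n)) \<le> exp 1 ^ card A * exp (- (2 * n))"
    by (intro mult_right_mono power_mono) auto
  also have "exp 1 ^ card A * exp (- (2 * n)) = exp (- n)"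
    by (simp add: n_def exp_of_nat_mult[symmetric] flip: exp_add)
  also have "{z. (\<Sum>j\<in>A. (R z j)\<^sup>2) / (4 * V) \<ge> 2 * n} = {z. (\<Sum>j\<in>A. (R z j)\<^sup>2) \<ge> 4 * n\<^sup>2 * v * a\<^sup>2}"
    using V by (simp add: pos_le_divide_eq) (simp add: V_def power2_eq_square mult_ac)
  finally show ?thesis by (simp add: R_def n_def)
qed

text \<open>Entry bounds of size \<open>sqrt (7 * x)\<close> give square norm
  \<open>7 * x * n\<close> for every row, and this is the variance level at which the inner products
  of distinct rows are controlled by \<open>7 * x * sqrt n\<close>. A Gram row then consists of one
  diagonal term \<open>7 * x * n\<close> and fewer than \<open>n\<close> off-diagonal ones, in total
  at most \<open>14 * x * n * sqrt n\<close>.\<close>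

lemma typical_matrix:
  fixes n :: nat and x :: real
  assumes n: "card A = n" "n \<ge> 2" and sym: "\<And>i j. \<alpha> i j = \<alpha> j i"
    and \<alpha>: "\<And>i j. i \<in> A \<Longrightarrow> j \<in> A \<Longrightarrow> \<bar>\<alpha> i j\<bar> \<le> a" and a: "a > 0"
  defines "x \<equiv> v * ln n"
  shows "measure_pmf.prob coins
    {z. \<not> ((\<forall>i\<in>A. (\<Sum>k\<in>A. X z i k)\<^sup>2 \<le> 7 * x * n) \<and>
           (\<forall>i\<in>A. (\<Sum>k\<in>A. \<bar>\<Sum>j\<in>A. X z i j * X z k j\<bar>) \<le> 14 * x * n * sqrt n) \<and>
           (\<Sum>j\<in>A. (\<Sum>k\<in>A. \<alpha> j k * X z j k)\<^sup>2) \<le> 4 * n\<^sup>2 * v * a\<^sup>2)}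
    \<le> 6 / real n ^ 12 + exp (- real n)"
proof -
  \<comment> \<open>Every threshold below is chosen to make the Hoeffding exponent equal to
    \<open>14 * ln n\<close>. At most \<open>2 * n^2 + n\<close> such events occur, which leaves
    \<open>6 / n^12\<close>.\<close>
  define \<epsilon> :: real where "\<epsilon> = 2 / real n ^ 14"
  have ln: "ln n > 0" using n by simp
  have x: "x > 0" using v_pos ln by (simp add: x_def)
  have exp14: "2 * exp (- (14 * ln n)) = \<epsilon>"
  proof -
    have "exp (14 * ln n) = real n ^ 14" using n exp_of_nat_mult[of 14 "ln n"] by simp
    thus ?thesis by (simp add: \<epsilon>_def exp_minus field_simps)
  qed
  define B1 where "B1 i k = {z. \<bar>X z i k\<bar> \<ge> sqrt (7 * x)}" for i k
  define B2 where "B2 i = {z. \<bar>\<Sum>k\<in>A. X z i k\<bar> \<ge> sqrt (7 * x * n)}" for i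
  define B3 where "B3 i k = {z. (\<Sum>j\<in>A. (X z i j)\<^sup>2) \<le> 7 * x * n \<and> \<bar>\<Sum>j\<in>A. X z i j * X z k j\<bar> \<ge> 7 * x * sqrt n}" for i k
  define B4 where "B4 = {z. (\<Sum>j\<in>A. (\<Sum>k\<in>A. \<alpha> j k * X z j k)\<^sup>2) \<ge> 4 * (real n)\<^sup>2 * v * a\<^sup>2}"
  define U where "U = {(i, k) \<in> A \<times> A. i \<noteq> k}"
  have U: "finite U" "card U \<le> n\<^sup>2"
  proof -
    have "U \<subseteq> A \<times> A" by (auto simp: U_def)
    thus "finite U" "card U \<le> n\<^sup>2"
      using finA n card_mono[of "A \<times> A" U]
      by (auto simp: card_cartesian_product power2_eq_square intro: finite_subset)
  qed
  have P1: "measure_pmf.prob coins (B1 i k) \<le> \<epsilon>" if "(i, k) \<in> U" for i k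
  proof -
    have "measure_pmf.prob coins {z. \<bar>\<Sum>(i, j)\<in>{(i, k)}. 1 * X z i j\<bar> \<ge> sqrt (7 * x)} \<le> 2 * exp (- 2 * (sqrt (7 * x))\<^sup>2 / (v * 1))"
      by (rule combination_tail) (use that x in \<open>auto simp: U_def\<close>)
    also have "- 2 * (sqrt (7 * x))\<^sup>2 / (v * 1) = - 14 * ln n" using x v_pos ln by (simp add: x_def)
    finally show ?thesis by (simp add: B1_def exp14)
  qed
  have P2: "measure_pmf.prob coins (B2 i) \<le> \<epsilon>" if i: "i \<in> A" for i
  proof -
    have row_eq: "(\<Sum>(i, j)\<in>{i} \<times> (A - {i}). 1 * X z i j) = (\<Sum>k\<in>A. X z i k)" for z
    proof -
      have "(\<Sum>(i, j)\<in>{i} \<times> (A - {i}). 1 * X z i j) = (\<Sum>k\<in>A - {i}. X z i k)"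
        by (simp flip: sum.cartesian_product)
      also have "\<dots> = (\<Sum>k\<in>A. X z i k)"
        using finA by (intro sum.mono_neutral_left) auto
      finally show ?thesis .
    qed
    have "measure_pmf.prob coins {z. \<bar>\<Sum>(i, j)\<in>{i} \<times> (A - {i}). 1 * X z i j\<bar> \<ge> sqrt (7 * x * n)}
        \<le> 2 * exp (- 2 * (sqrt (7 * x * n))\<^sup>2 / (v * n))"
    proof (rule combination_tail)
      show "(\<Sum>(i, j)\<in>{i} \<times> (A - {i}). (1 :: real)\<^sup>2) \<le> n"
        using card_Diff1_le[of A i] n by (simp add: card_cartesian_product)
    qed (use i x n in auto)
    also have "- 2 * (sqrt (7 * x * n))\<^sup>2 / (v * n) = - 14 * ln n"
      using x v_pos n by (simp add: x_def)
    finally show ?thesis unfolding row_eq by (simp add: B2_def exp14)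
  qed
  have P3: "measure_pmf.prob coins (B3 i k) \<le> \<epsilon>" if "(i, k) \<in> U" for i k
  proof -
    have "measure_pmf.prob coins (B3 i k) \<le> 2 * exp (- 2 * (7 * x * sqrt n)\<^sup>2 / (v * (7 * x * n)))"
      unfolding B3_def by (rule row_product_tail) (use that x n in \<open>auto simp: U_def\<close>)
    also have "- 2 * (7 * x * sqrt n)\<^sup>2 / (v * (7 * x * n)) = - 14 * (x / v)"
      using x v_pos n by (simp add: power_mult_distrib power2_eq_square[of x])
    also have "x / v = ln n" using v_pos by (simp add: x_def)
    finally show ?thesis by (simp add: exp14)
  qed
  have P4: "measure_pmf.prob coins B4 \<le> exp (- real n)"
    unfolding B4_def n(1)[symmetric]
    by (rule weighted_row_sums_tail[OF _ sym \<alpha> a]) (use n in auto)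
  define W where "W = (\<Union>(i, k)\<in>U. B1 i k) \<union> (\<Union>i\<in>A. B2 i) \<union> (\<Union>(i, k)\<in>U. B3 i k) \<union> B4"
  have "measure_pmf.prob coins {z. \<not> ((\<forall>i\<in>A. (\<Sum>k\<in>A. X z i k)\<^sup>2 \<le> 7 * x * n) \<and>
           (\<forall>i\<in>A. (\<Sum>k\<in>A. \<bar>\<Sum>j\<in>A. X z i j * X z k j\<bar>) \<le> 14 * x * n * sqrt n) \<and>
           (\<Sum>j\<in>A. (\<Sum>k\<in>A. \<alpha> j k * X z j k)\<^sup>2) \<le> 4 * n\<^sup>2 * v * a\<^sup>2)} \<le> measure_pmf.prob coins W"
  proof (intro measure_pmf.finite_measure_mono subsetI CollectI)
    fix z
    assume bad: "z \<in> {z. \<not> ((\<forall>i\<in>A. (\<Sum>k\<in>A. X z i k)\<^sup>2 \<le> 7 * x * n) \<and>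
           (\<forall>i\<in>A. (\<Sum>k\<in>A. \<bar>\<Sum>j\<in>A. X z i j * X z k j\<bar>) \<le> 14 * x * n * sqrt n) \<and>
           (\<Sum>j\<in>A. (\<Sum>k\<in>A. \<alpha> j k * X z j k)\<^sup>2) \<le> 4 * n\<^sup>2 * v * a\<^sup>2)}"
    show "z \<in> W"
    proof (rule ccontr)
      assume z: "z \<notin> W"
      have 2: "(\<Sum>k\<in>A. X z i k)\<^sup>2 \<le> 7 * x * n" if "i \<in> A" for i
      proof -
        have "\<bar>\<Sum>k\<in>A. X z i k\<bar> \<le> sqrt (7 * x * n)" using z that by (auto simp: W_def B2_def)
        hence "(\<bar>\<Sum>k\<in>A. X z i k\<bar>)\<^sup>2 \<le> (sqrt (7 * x * n))\<^sup>2" by (intro power_mono) auto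
        thus ?thesis using x by simp
      qed
      have 1: "(X z i k)\<^sup>2 \<le> 7 * x" if "i \<in> A" "k \<in> A" for i k
      proof (cases "i = k")
        case False
        hence "z \<notin> B1 i k" using z that by (auto simp: W_def U_def)
        hence "\<bar>X z i k\<bar> \<le> sqrt (7 * x)" by (simp add: B1_def)
        hence "(\<bar>X z i k\<bar>)\<^sup>2 \<le> (sqrt (7 * x))\<^sup>2" by (intro power_mono) auto
        thus ?thesis using x by simp
      qed (use x in simp)
      have 0: "(\<Sum>j\<in>A. (X z i j)\<^sup>2) \<le> 7 * x * n" if i: "i \<in> A" for i
        using sum_mono[of A "\<lambda>j. (X z i j)\<^sup>2" "\<lambda>_. 7 * x"] 1[OF i] n by (simp add: mult.commute)
      have 3: "(\<Sum>k\<in>A. \<bar>\<Sum>j\<in>A. X z i j * X z k j\<bar>) \<le> 14 * x * n * sqrt n" if i: "i \<in> A" for i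
      proof -
        have "(\<Sum>k\<in>A. \<bar>\<Sum>j\<in>A. X z i j * X z k j\<bar>) =
            \<bar>\<Sum>j\<in>A. X z i j * X z i j\<bar> + (\<Sum>k\<in>A - {i}. \<bar>\<Sum>j\<in>A. X z i j * X z k j\<bar>)"
          by (rule sum.remove[OF finA i])
        also have "\<bar>\<Sum>j\<in>A. X z i j * X z i j\<bar> \<le> 7 * x * n"
          using 0[OF i] by (simp add: power2_eq_square sum_nonneg)
        also have "(\<Sum>k\<in>A - {i}. \<bar>\<Sum>j\<in>A. X z i j * X z k j\<bar>) \<le> (\<Sum>k\<in>A - {i}. 7 * x * sqrt n)"
        proof (intro sum_mono)
          fix k assume k: "k \<in> A - {i}"
          have "z \<notin> B3 i k" using z i k by (auto simp: W_def U_def)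
          thus "\<bar>\<Sum>j\<in>A. X z i j * X z k j\<bar> \<le> 7 * x * sqrt n"
            using 0[OF i] by (simp add: B3_def)
        qed
        also have "\<dots> \<le> n * (7 * x * sqrt n)"
          using card_Diff1_le[of A i] n x by (simp add: mult_right_mono)
        also have "7 * x * n \<le> n * (7 * x * sqrt n)"
        proof -
          have "7 * x * n * 1 \<le> 7 * x * n * sqrt n" using n x by (intro mult_left_mono) auto
          thus ?thesis by (simp add: mult_ac)
        qed
        finally show ?thesis by (simp add: mult_ac)
      qed
      have 4: "(\<Sum>j\<in>A. (\<Sum>k\<in>A. \<alpha> j k * X z j k)\<^sup>2) \<le> 4 * n\<^sup>2 * v * a\<^sup>2"
        using z by (simp add: W_def B4_def)
      show False using bad 2 3 4 by blast
    qed
  qed auto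
  also have "\<dots> \<le> n\<^sup>2 * \<epsilon> + n * \<epsilon> + n\<^sup>2 * \<epsilon> + exp (- real n)"
  proof -
    have \<epsilon>: "\<epsilon> \<ge> 0" by (simp add: \<epsilon>_def)
    have pairs: "measure_pmf.prob coins (\<Union>(i, k)\<in>U. C i k) \<le> n\<^sup>2 * \<epsilon>"
      if "\<And>i k. (i, k) \<in> U \<Longrightarrow> measure_pmf.prob coins (C i k) \<le> \<epsilon>" for C
    proof -
      have "measure_pmf.prob coins (\<Union>(i, k)\<in>U. C i k) \<le> (\<Sum>u\<in>U. measure_pmf.prob coins (case u of (i, k) \<Rightarrow> C i k))"
        by (rule measure_UNION_le) (use U in auto)
      also have "\<dots> \<le> (\<Sum>u\<in>U. \<epsilon>)" by (intro sum_mono) (auto intro: that)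
      also have "\<dots> \<le> n\<^sup>2 * \<epsilon>" using U(2) \<epsilon> by (simp add: mult_right_mono flip: of_nat_power)
      finally show ?thesis .
    qed
    have "measure_pmf.prob coins (\<Union>i\<in>A. B2 i) \<le> (\<Sum>i\<in>A. measure_pmf.prob coins (B2 i))"
      by (rule measure_UNION_le) (use finA in auto)
    also have "\<dots> \<le> (\<Sum>i\<in>A. \<epsilon>)" by (intro sum_mono P2)
    finally have "measure_pmf.prob coins (\<Union>i\<in>A. B2 i) \<le> n * \<epsilon>" using n by simp
    moreover have "measure_pmf.prob coins W \<le> measure_pmf.prob coins (\<Union>(i, k)\<in>U. B1 i k) +
        measure_pmf.prob coins (\<Union>i\<in>A. B2 i) + measure_pmf.prob coins (\<Union>(i, k)\<in>U. B3 i k) + measure_pmf.prob coins B4"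
      unfolding W_def by (intro order_trans[OF measure_Un_le] add_right_mono) auto
    ultimately show ?thesis using pairs[of B1, OF P1] pairs[of B3, OF P3] P4 by linarith
  qed
  also have "n\<^sup>2 * \<epsilon> + n * \<epsilon> + n\<^sup>2 * \<epsilon> \<le> 6 / real n ^ 12"
  proof -
    have "n * \<epsilon> \<le> n\<^sup>2 * \<epsilon>" using n by (intro mult_right_mono) (auto simp: \<epsilon>_def power2_eq_square)
    moreover have "n\<^sup>2 * \<epsilon> = 2 / real n ^ 12"
      using n power_add[of "real n" 2 12] by (simp add: \<epsilon>_def field_simps)
    ultimately show ?thesis by simp
  qed
  finally show ?thesis by simp
qed

end

section \<open>The comparison graphs\<close>

lemma finite_vertex_pairs: "finite (vertex_pairs n)"
  by (rule finite_subset[of _ "Pow {1..n}"]) (auto simp: vertex_pairs_def)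

lemma finite_grid: "finite (grid T)"
  by (simp add: grid_def)

lemma nbhd_subset_grid: "nbhd T \<delta> t \<subseteq> grid T"
  by (auto simp: nbhd_def)

lemma finite_nbhd: "finite (nbhd T \<delta> t)"
  using finite_subset[OF nbhd_subset_grid finite_grid] .

lemma erdos_renyi_edge:
  assumes "e \<in> vertex_pairs n"
  shows "map_pmf (\<lambda>H. e \<in> H) (erdos_renyi n q) = bernoulli_pmf q"
proof -
  have "map_pmf (\<lambda>H. e \<in> H) (erdos_renyi n q) =
      map_pmf (\<lambda>f. f e) (Pi_pmf (vertex_pairs n) False (\<lambda>_. bernoulli_pmf q))"
    using assms by (simp add: erdos_renyi_def map_pmf_comp)
  also have "\<dots> = bernoulli_pmf q"
    using assms by (subst Pi_pmf_component) (auto simp: finite_vertex_pairs)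
  finally show ?thesis .
qed

lemma finite_set_erdos_renyi: "finite (set_pmf (erdos_renyi n q))"
  unfolding erdos_renyi_def set_map_pmf
  by (intro finite_imageI finite_set_Pi_pmf finite_vertex_pairs) auto

text \<open>Chernoff bound with parameter 1 for a sum of independent indicators over the grid. As
  \<open>exp 1 \<ge> 5/2\<close>, the moment is at most \<open>exp (- 6/10 * p_sum)\<close>;
  Markov's inequality at half the mean gives back \<open>exp (p_sum / 2)\<close>, and
  \<open>6/10 - 1/2 = 1/10\<close>.\<close>

lemma few_edges_tail:
  assumes ij: "i \<in> {1..n}" "j \<in> {1..n}" "i \<noteq> j"
    and p: "\<And>s. s \<in> grid T \<Longrightarrow> 0 \<le> p s \<and> p s \<le> 1"
  shows "measure_pmf.prob (graphs_pmf n T p)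
      {G. real (card (edge_nbhd T G \<delta> t i j)) \<le> p_sum T p \<delta> t / 2} \<le> exp (- p_sum T p \<delta> t / 10)"
proof -
  define e where "e = {i, j}"
  have e: "e \<in> vertex_pairs n" using ij by (auto simp: e_def vertex_pairs_def)
  \<comment> \<open>The factor is identically 1 at grid times outside the neighborhood, so the
    product runs over the whole index set of the product law.\<close>
  define F :: "real \<Rightarrow> nat set set \<Rightarrow> real"
    where "F s H = exp (- of_bool (s \<in> nbhd T \<delta> t \<and> e \<in> H))" for s H
  have fin: "finite (set_pmf (graphs_pmf n T p))"
    unfolding graphs_pmf_def by (intro finite_set_Pi_pmf finite_grid finite_set_erdos_renyi)
  have card_eq: "exp (- real (card (edge_nbhd T G \<delta> t i j))) = (\<Prod>s\<in>grid T. F s (G s))" for G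
  proof -
    have "real (card (edge_nbhd T G \<delta> t i j)) = (\<Sum>s\<in>grid T. of_bool (s \<in> nbhd T \<delta> t \<and> e \<in> G s))"
    proof -
      have "edge_nbhd T G \<delta> t i j = {s \<in> grid T. s \<in> nbhd T \<delta> t \<and> e \<in> G s}"
        using nbhd_subset_grid by (auto simp: edge_nbhd_def e_def)
      thus ?thesis using finite_grid by (simp add: sum.If_cases of_bool_def Int_def)
    qed
    thus ?thesis by (simp only: F_def exp_sum[OF finite_grid, symmetric] sum_negf)
  qed
  have factor: "measure_pmf.expectation (erdos_renyi n (p s)) (F s) \<le>
      exp (- (if s \<in> nbhd T \<delta> t then 6/10 * p s else 0))" if s: "s \<in> grid T" for s
  proof (cases "s \<in> nbhd T \<delta> t")
    case True
    have e1: "exp (- 1 :: real) \<le> 4/10"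
      using exp_lower_Taylor_quadratic[of 1] by (simp add: exp_minus field_simps)
    have "measure_pmf.expectation (erdos_renyi n (p s)) (F s) =
        measure_pmf.expectation (map_pmf (\<lambda>H. e \<in> H) (erdos_renyi n (p s))) (\<lambda>b. exp (- of_bool b))"
      using True by (simp add: F_def[abs_def])
    also have "\<dots> = p s * exp (- 1) + (1 - p s)"
      unfolding erdos_renyi_edge[OF e] using p[OF s] by (simp add: integral_bernoulli_pmf)
    also have "\<dots> \<le> 1 + - (6/10 * p s)"
      using mult_left_mono[OF e1, of "p s"] p[OF s] by simp
    also have "\<dots> \<le> exp (- (6/10 * p s))" by (rule exp_ge_add_one_self)
    finally show ?thesis using True by simp
  qed (simp add: F_def[abs_def])
  have "measure_pmf.expectation (graphs_pmf n T p) (\<lambda>G. exp (- real (card (edge_nbhd T G \<delta> t i j)))) =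
      (\<Prod>s\<in>grid T. measure_pmf.expectation (erdos_renyi n (p s)) (F s))"
    unfolding card_eq graphs_pmf_def
    by (rule expectation_prod_Pi_pmf)
       (auto simp: F_def finite_grid intro: integrable_measure_pmf_finite finite_set_erdos_renyi)
  also have "\<dots> \<le> (\<Prod>s\<in>grid T. exp (- (if s \<in> nbhd T \<delta> t then 6/10 * p s else 0)))"
    by (intro prod_mono conjI factor Bochner_Integration.integral_nonneg) (auto simp: F_def)
  also have "\<dots> = exp (- (6/10 * p_sum T p \<delta> t))"
  proof -
    have "(\<Sum>s\<in>grid T. if s \<in> nbhd T \<delta> t then 6/10 * p s else 0) = 6/10 * p_sum T p \<delta> t"
      unfolding p_sum_def sum_distrib_left using finite_grid nbhd_subset_grid[of T \<delta> t]
      by (subst sum.inter_restrict[symmetric]) (auto simp: Int_absorb1)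
    thus ?thesis by (simp only: exp_sum[OF finite_grid, symmetric] sum_negf)
  qed
  finally have "measure_pmf.prob (graphs_pmf n T p)
      {G. - real (card (edge_nbhd T G \<delta> t i j)) \<ge> - (p_sum T p \<delta> t / 2)} \<le>
      exp (- (6/10 * p_sum T p \<delta> t)) * exp (- (- (p_sum T p \<delta> t / 2)))"
    by (rule pmf_exp_Markov[OF fin])
  also have "\<dots> = exp (- p_sum T p \<delta> t / 10)" by (simp flip: exp_add)
  finally show ?thesis by simp
qed

text \<open>By \<open>1 - p \<le> exp (- p)\<close> a large expected number of comparisons forces
  the union edge probability close to 1; the normalization is then comparable to
  \<open>n\<close>.\<close>

lemma p_union_bounds:
  assumes p: "\<And>s. s \<in> grid T \<Longrightarrow> 0 \<le> p s \<and> p s \<le> 1"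
  shows "p_union T p \<delta> t \<le> 1" and "1 - exp (- p_sum T p \<delta> t) \<le> p_union T p \<delta> t"
proof -
  have p': "0 \<le> p s" "p s \<le> 1" if "s \<in> nbhd T \<delta> t" for s
    using p nbhd_subset_grid that by blast+
  show "p_union T p \<delta> t \<le> 1" unfolding p_union_def using p' by (simp add: prod_nonneg)
  have "(\<Prod>s\<in>nbhd T \<delta> t. 1 - p s) \<le> (\<Prod>s\<in>nbhd T \<delta> t. exp (- p s))"
    using p' exp_ge_add_one_self[of "- p s" for s] by (intro prod_mono) auto
  also have "\<dots> = exp (- p_sum T p \<delta> t)" by (simp add: p_sum_def exp_sum finite_nbhd flip: sum_negf)
  finally show "1 - exp (- p_sum T p \<delta> t) \<le> p_union T p \<delta> t" by (simp add: p_union_def)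
qed

section \<open>The estimated transition matrix\<close>

text \<open>Coins are stored only for increasing pairs; \<open>min\<close> and \<open>max\<close>
  give the same block for both orientations.\<close>

definition coin_block :: "nat \<Rightarrow> nat \<Rightarrow> (real \<Rightarrow> nat set set) \<Rightarrow> real \<Rightarrow> real \<Rightarrow> nat \<Rightarrow> nat \<Rightarrow> (real \<times> nat \<times> nat \<times> nat) set" where
  "coin_block T L G \<delta> t i j = (\<lambda>(s, l). (s, min i j, max i j, l)) ` (edge_nbhd T G \<delta> t i j \<times> {1..L})"

text \<open>The error from averaging over the neighborhood instead of observing at \<open>t\<close>;
  it is deterministic once the graphs are fixed. The value 0 on the diagonal keeps it
  antisymmetric.\<close>

definition bias :: "nat \<Rightarrow> (real \<Rightarrow> nat \<Rightarrow> real) \<Rightarrow> (real \<Rightarrow> nat set set) \<Rightarrow> real \<Rightarrow> real \<Rightarrow> nat \<Rightarrow> nat \<Rightarrow> real" where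
  "bias T w G \<delta> t i j = (if i = j then 0 else
     (\<Sum>s\<in>edge_nbhd T G \<delta> t i j. y_star w i j s - y_star w i j t) / card (edge_nbhd T G \<delta> t i j))"

lemma edge_nbhd_commute: "edge_nbhd T G \<delta> t i j = edge_nbhd T G \<delta> t j i"
  by (simp add: edge_nbhd_def insert_commute)

lemma grid_subset: "grid T \<subseteq> {0..1}"
  by (auto simp: grid_def divide_le_eq_1)

lemma y_star_commute:
  assumes "w s i > 0" "w s j > 0"
  shows "y_star w j i s = 1 - y_star w i j s"
  using assms by (simp add: y_star_def field_simps)

lemma y_star_bounds:
  assumes "w s i > 0" "w s j > 0"
  shows "y_star w i j s \<in> {0..1}"
  using assms by (simp add: y_star_def)

lemma inj_on_coin: "inj_on (\<lambda>(s, l). (s, a, b, l)) S"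
  by (auto simp: inj_on_def)

lemma card_coin_block: "card (coin_block T L G \<delta> t i j) = card (edge_nbhd T G \<delta> t i j) * L"
  unfolding coin_block_def by (subst card_image[OF inj_on_coin]) (simp add: card_cartesian_product)

text \<open>A fixed realization of the graphs in which every pair is compared at least
  \<open>m\<close> times near \<open>t\<close>. A block then has at least \<open>L * m\<close>
  coins, whence the variance level \<open>1 / (L * m)\<close>.\<close>

locale dense_btl =
  fixes n T L :: nat and w :: "real \<Rightarrow> nat \<Rightarrow> real" and G :: "real \<Rightarrow> nat set set" and \<delta> t m :: real
  assumes L: "L \<ge> 1" and m: "m > 0"
    and w: "\<And>s i. s \<in> {0..1} \<Longrightarrow> i \<in> {1..n} \<Longrightarrow> w s i > 0"
    and t: "t \<in> {0..1}"
    and dense: "\<And>i j. i \<in> {1..n} \<Longrightarrow> j \<in> {1..n} \<Longrightarrow> i \<noteq> j \<Longrightarrow> m \<le> card (edge_nbhd T G \<delta> t i j)"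
begin

sublocale bernoulli_matrix "{1..n}" "observations n T L G" "coin_block T L G \<delta> t"
  "\<lambda>x. case x of (s, i, j, l) \<Rightarrow> y_star w i j s" "1 / (L * m)"
proof
  have "observations n T L G \<subseteq> grid T \<times> {1..n} \<times> {1..n} \<times> {1..L}"
    by (auto simp: observations_def)
  thus "finite (observations n T L G)"
    by (rule finite_subset) (auto simp: finite_grid)
  show "(case x of (s, i, j, l) \<Rightarrow> y_star w i j s) \<in> {0..1}" if "x \<in> observations n T L G" for x
  proof -
    obtain s i j l where x: "x = (s, i, j, l)" by (metis surj_pair)
    have "s \<in> {0..1}" "i \<in> {1..n}" "j \<in> {1..n}"
      using that grid_subset[of T] by (auto simp: x observations_def)
    thus ?thesis using y_star_bounds[of w s i j] w by (simp add: x)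
  qed
  show "coin_block T L G \<delta> t i j = coin_block T L G \<delta> t j i" for i j
    by (simp add: coin_block_def edge_nbhd_commute[of T G \<delta> t i j] min.commute max.commute)
  show "coin_block T L G \<delta> t i j \<subseteq> observations n T L G" if "i \<in> {1..n}" "j \<in> {1..n}" "i \<noteq> j" for i j
    using that nbhd_subset_grid[of T \<delta> t]
    by (auto simp: coin_block_def observations_def edge_nbhd_def min_def max_def insert_commute)
  show "{i, j} = {k, l}" if "x \<in> coin_block T L G \<delta> t i j" "x \<in> coin_block T L G \<delta> t k l" for i j k l x
    using that by (auto simp: coin_block_def min_def max_def split: if_splits)
  show "1 / (L * m) > 0" using L m by simp
  show "1 \<le> 1 / (L * m) * card (coin_block T L G \<delta> t i j)" if "i \<in> {1..n}" "j \<in> {1..n}" "i \<noteq> j" for i j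
    using dense[OF that] L m by (simp add: card_coin_block field_simps)
qed simp

lemma outcomes_eq_coins: "outcomes_pmf n T L w G = coins"
  unfolding outcomes_pmf_def by (rule arg_cong[where f = "Pi_pmf _ _"]) auto

lemma edge_nbhd_card_pos:
  assumes "i \<in> {1..n}" "j \<in> {1..n}" "i \<noteq> j"
  shows "card (edge_nbhd T G \<delta> t i j) > 0"
  using dense[OF assms] m by (cases "card (edge_nbhd T G \<delta> t i j)") auto

text \<open>Splits the empirical frequency into truth at \<open>t\<close>, centered noise and
  smoothing bias. Each comparison time has the same weight and carries \<open>L\<close> coins, so
  the average over times of averages over coins is a plain average over the block.\<close>

lemma mean_outcome_eq:
  assumes ij: "i \<in> {1..n}" "j \<in> {1..n}" "i \<noteq> j"
  shows "(\<Sum>s\<in>edge_nbhd T G \<delta> t i j. y_bar L z i j s) / card (edge_nbhd T G \<delta> t i j) =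
    y_star w i j t + (X z i j + bias T w G \<delta> t i j)"
proof -
  define N where "N = edge_nbhd T G \<delta> t i j"
  have N: "card N > 0" using edge_nbhd_card_pos[OF ij] by (simp add: N_def)
  \<comment> \<open>For \<open>i > j\<close> the outcome and its mean are both complements of those
    of the stored coin, so centering flips the sign exactly as in \<open>coef\<close>.\<close>
  define \<sigma> :: real where "\<sigma> = (if i < j then 1 else -1)"
  have "X z i j = (\<Sum>x\<in>coin_block T L G \<delta> t i j. \<sigma> / (card N * L) *
      (of_bool (z x) - (case x of (s, i, j, l) \<Rightarrow> y_star w i j s)))"
    unfolding X_def using blk_subset[OF ij] finI ij(3)
    by (intro sum.mono_neutral_cong_right) (auto simp: coef_def card_coin_block N_def \<sigma>_def)
  also have "\<dots> = (\<Sum>(s, l)\<in>N \<times> {1..L}. \<sigma> / (card N * L) *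
      (of_bool (z (s, min i j, max i j, l)) - y_star w (min i j) (max i j) s))"
    unfolding coin_block_def N_def by (subst sum.reindex[OF inj_on_coin]) (simp add: case_prod_unfold)
  also have "\<dots> = (\<Sum>s\<in>N. \<Sum>l\<in>{1..L}. (outcome z l i j s - y_star w i j s) / (card N * L))"
    unfolding sum.cartesian_product[symmetric]
  proof (intro sum.cong refl)
    fix s l assume "s \<in> N"
    hence "s \<in> {0..1}" using nbhd_subset_grid[of T \<delta> t] grid_subset[of T] by (auto simp: N_def edge_nbhd_def)
    hence "w s i > 0" "w s j > 0" using w ij by auto
    hence "y_star w j i s = 1 - y_star w i j s" by (rule y_star_commute)
    thus "\<sigma> / (card N * L) * (of_bool (z (s, min i j, max i j, l)) - y_star w (min i j) (max i j) s) =
        (outcome z l i j s - y_star w i j s) / (card N * L)"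
      using ij(3) by (cases "i < j") (auto simp: \<sigma>_def outcome_def min_def max_def diff_divide_distrib)
  qed
  also have "\<dots> = (\<Sum>s\<in>N. (y_bar L z i j s - y_star w i j s) / card N)"
  proof (intro sum.cong refl)
    fix s
    define S where "S = (\<Sum>l\<in>{1..L}. outcome z l i j s)"
    have "(\<Sum>l\<in>{1..L}. (outcome z l i j s - y_star w i j s) / (card N * L)) = (S - L * y_star w i j s) / (card N * L)"
      by (simp add: S_def sum_subtractf flip: sum_divide_distrib)
    also have "\<dots> = (S / L - y_star w i j s) / card N"
      using L N by (simp add: field_simps)
    finally show "(\<Sum>l\<in>{1..L}. (outcome z l i j s - y_star w i j s) / (card N * L)) =
        (y_bar L z i j s - y_star w i j s) / card N"
      by (simp add: S_def y_bar_def)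
  qed
  finally have "X z i j = (\<Sum>s\<in>N. (y_bar L z i j s - y_star w i j s) / card N)" .
  moreover have "bias T w G \<delta> t i j = (\<Sum>s\<in>N. (y_star w i j s - y_star w i j t) / card N)"
    using ij(3) by (simp add: bias_def N_def sum_divide_distrib)
  ultimately have "X z i j + bias T w G \<delta> t i j = (\<Sum>s\<in>N. (y_bar L z i j s - y_star w i j t) / card N)"
    by (simp add: diff_divide_distrib flip: sum.distrib)
  also have "\<dots> = (\<Sum>s\<in>N. y_bar L z i j s) / card N - y_star w i j t"
    using N by (simp add: sum_subtractf flip: sum_divide_distrib) (simp add: diff_divide_distrib)
  finally show ?thesis by (simp add: N_def)
qed

lemma bias_antisym:
  assumes ij: "i \<in> {1..n}" "j \<in> {1..n}"
  shows "bias T w G \<delta> t i j = - bias T w G \<delta> t j i"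
proof (cases "i = j")
  case False
  have "y_star w j i s = 1 - y_star w i j s" if "s \<in> {0..1}" for s
    using y_star_commute w ij that by blast
  moreover have "s \<in> {0..1}" if "s \<in> edge_nbhd T G \<delta> t i j" for s
    using that nbhd_subset_grid[of T \<delta> t] grid_subset[of T] by (auto simp: edge_nbhd_def)
  ultimately have "(\<Sum>s\<in>edge_nbhd T G \<delta> t i j. y_star w j i s - y_star w j i t) =
      (\<Sum>s\<in>edge_nbhd T G \<delta> t i j. - (y_star w i j s - y_star w i j t))"
    using t by (intro sum.cong) auto
  thus ?thesis using False
    by (simp add: bias_def edge_nbhd_commute[of T G \<delta> t j i] sum_negf del: minus_diff_eq)
qed (simp add: bias_def)

lemma bias_bound:
  fixes M :: real
  assumes ij: "i \<in> {1..n}" "j \<in> {1..n}" and M: "M \<ge> 0" and \<delta>: "\<delta> \<ge> 0"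
    and smooth: "\<And>s. s \<in> {0..1} \<Longrightarrow> i \<noteq> j \<Longrightarrow> \<bar>y_star w i j s - y_star w i j t\<bar> \<le> M * \<bar>s - t\<bar>"
  shows "\<bar>bias T w G \<delta> t i j\<bar> \<le> M * \<delta> / T"
proof (cases "i = j")
  case False
  define N where "N = edge_nbhd T G \<delta> t i j"
  have N: "card N > 0" using edge_nbhd_card_pos[OF ij False] by (simp add: N_def)
  have "\<bar>\<Sum>s\<in>N. y_star w i j s - y_star w i j t\<bar> \<le> (\<Sum>s\<in>N. M * \<delta> / T)"
  proof (rule order_trans[OF sum_abs], intro sum_mono)
    fix s assume s: "s \<in> N"
    have s': "s \<in> {0..1}" "\<bar>s - t\<bar> \<le> \<delta> / T"
      using s grid_subset[of T] by (auto simp: N_def edge_nbhd_def nbhd_def abs_minus_commute)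
    have "\<bar>y_star w i j s - y_star w i j t\<bar> \<le> M * \<bar>s - t\<bar>"
      by (rule smooth[OF s'(1) False])
    also have "\<dots> \<le> M * (\<delta> / T)" by (rule mult_left_mono[OF s'(2) M])
    finally show "\<bar>y_star w i j s - y_star w i j t\<bar> \<le> M * \<delta> / T" by simp
  qed
  thus ?thesis using N False by (simp add: bias_def N_def abs_divide field_simps)
qed (use M \<delta> in \<open>simp add: bias_def\<close>)

end

lemma b_ratio_ge:
  assumes "i \<in> {1..n}" "j \<in> {1..n}"
  shows "w t i / w t j \<le> b_ratio n w t"
proof -
  have "finite {w t i / w t j | i j. i \<in> {1..n} \<and> j \<in> {1..n}}"
    by (rule finite_image_set2) simp_all
  thus ?thesis unfolding b_ratio_def using assms by (intro Max_ge) blast+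
qed

text \<open>Turns the exponents 7/2 and 9/2 into natural powers of
  \<open>r = sqrt b\<close>.\<close>

lemma powr_half_integer:
  assumes "b > 0"
  shows "b powr (real k / 2) = sqrt b ^ k"
proof -
  have "b powr (real k / 2) = (b powr (1/2)) powr (real k)" by (simp add: powr_powr)
  also have "\<dots> = sqrt b ^ k" using assms by (simp add: powr_half_sqrt powr_realpow)
  finally show ?thesis .
qed

context dense_btl
begin

lemma P_hat_off_eq:
  assumes ij: "i \<in> {1..n}" "j \<in> {1..n}" "i \<noteq> j"
  shows "P_hat_off T L d \<delta> t G z i j = (y_star w i j t + (X z i j + bias T w G \<delta> t i j)) / d"
proof -
  have "edge_nbhd T G \<delta> t i j \<noteq> {}" using edge_nbhd_card_pos[OF ij] by (metis card.empty less_irrefl)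
  hence "{i, j} \<in> union_edges T G \<delta> t" by (auto simp: edge_nbhd_def union_edges_def)
  hence "P_hat_off T L d \<delta> t G z i j = (\<Sum>s\<in>edge_nbhd T G \<delta> t i j. y_bar L z i j s) / card (edge_nbhd T G \<delta> t i j) / d"
    by (simp add: P_hat_off_def mult.commute)
  thus ?thesis by (simp only: mean_outcome_eq[OF ij])
qed

lemma P_hat_off_bounds:
  assumes ij: "i \<in> {1..n}" "j \<in> {1..n}" "i \<noteq> j" and d: "d > 0"
  shows "0 \<le> P_hat_off T L d \<delta> t G z i j" "P_hat_off T L d \<delta> t G z i j \<le> 1 / d"
proof -
  have out: "0 \<le> outcome z l i j s" "outcome z l i j s \<le> 1" for l s
    by (auto simp: outcome_def)
  have y: "0 \<le> y_bar L z i j s" "y_bar L z i j s \<le> 1" for s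
  proof -
    show "0 \<le> y_bar L z i j s" using out by (simp add: y_bar_def sum_nonneg)
    have "(\<Sum>l\<in>{1..L}. outcome z l i j s) \<le> (\<Sum>l\<in>{1..L}. 1)" using out by (intro sum_mono) auto
    thus "y_bar L z i j s \<le> 1" using L by (simp add: y_bar_def)
  qed
  define N where "N = edge_nbhd T G \<delta> t i j"
  have "(\<Sum>s\<in>N. y_bar L z i j s) \<le> (\<Sum>s\<in>N. 1)" using y by (intro sum_mono) auto
  define c where "c = (\<Sum>s\<in>N. y_bar L z i j s) / card N"
  have "c \<le> 1"
    using \<open>(\<Sum>s\<in>N. y_bar L z i j s) \<le> _\<close> edge_nbhd_card_pos[OF ij] by (simp add: c_def N_def)
  moreover have "0 \<le> c" using y by (simp add: c_def sum_nonneg)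
  moreover have "P_hat_off T L d \<delta> t G z i j = c / d"
    unfolding P_hat_off_eq[OF ij] c_def N_def mean_outcome_eq[OF ij] ..
  ultimately show "0 \<le> P_hat_off T L d \<delta> t G z i j" "P_hat_off T L d \<delta> t G z i j \<le> 1 / d"
    using d by (simp_all add: divide_right_mono)
qed

text \<open>Off-diagonal entries are frequencies divided by \<open>d\<close>, so fewer than
  \<open>n\<close> of them sum to at most \<open>n / d\<close>, and the diagonal stays
  nonnegative.\<close>

lemma stochastic_P_hat:
  fixes d :: real
  assumes d: "d > 0" "n \<le> d"
  shows "stochastic_matrix n (P_hat n T L d \<delta> t G z)"
  unfolding stochastic_matrix_def
proof (intro conjI ballI)
  fix i assume i: "i \<in> {1..n}"
  show "(\<Sum>j\<in>{1..n}. P_hat n T L d \<delta> t G z i j) = 1"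
  proof -
    have "(\<Sum>j\<in>{1..n}. P_hat n T L d \<delta> t G z i j) =
        P_hat n T L d \<delta> t G z i i + (\<Sum>j\<in>{1..n} - {i}. P_hat n T L d \<delta> t G z i j)"
      using i by (intro sum.remove) auto
    also have "(\<Sum>j\<in>{1..n} - {i}. P_hat n T L d \<delta> t G z i j) = (\<Sum>j\<in>{1..n} - {i}. P_hat_off T L d \<delta> t G z i j)"
      by (intro sum.cong refl) (auto simp: P_hat_def)
    finally show ?thesis by (simp add: P_hat_def)
  qed
  fix j assume j: "j \<in> {1..n}"
  show "0 \<le> P_hat n T L d \<delta> t G z i j"
  proof (cases "i = j")
    case True
    have "(\<Sum>k\<in>{1..n} - {i}. P_hat_off T L d \<delta> t G z i k) \<le> (\<Sum>k\<in>{1..n} - {i}. 1 / d)"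
      using P_hat_off_bounds(2)[OF i _ _ d(1)] by (intro sum_mono) auto
    also have "\<dots> \<le> n * (1 / d)" using d card_Diff1_le[of "{1..n}" i] by (simp add: divide_right_mono)
    also have "\<dots> \<le> 1" using d by simp
    finally show ?thesis using True by (simp add: P_hat_def)
  qed (use P_hat_off_bounds(1)[OF i j _ d(1)] in \<open>simp add: P_hat_def\<close>)
qed

end

text \<open>Given good graphs, only the coins are random. The work lies in deducing the size
  conditions of the deterministic perturbation bound from \<open>small\<close> and
  \<open>S\<close>.\<close>

lemma conditional_error_bound:
  fixes n T L :: nat and M \<delta> t d q S :: real and w :: "real \<Rightarrow> nat \<Rightarrow> real" and G :: "real \<Rightarrow> nat set set"
  defines "b \<equiv> b_ratio n w t"
  assumes n: "n \<ge> 2" and L: "L \<ge> 1" and M: "M \<ge> 0"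
    and w: "\<forall>s\<in>{0..1}. \<forall>i\<in>{1..n}. w s i > 0"
    and smooth: "\<forall>s\<in>{0..1}. \<forall>s'\<in>{0..1}. \<forall>i\<in>{1..n}. \<forall>j\<in>{1..n}. i \<noteq> j \<longrightarrow>
           \<bar>y_star w i j s - y_star w i j s'\<bar> \<le> M * \<bar>s - s'\<bar>"
    and t: "t \<in> {0..1}" and \<delta>: "\<delta> \<ge> 0"
    and d: "d = 3 * real n * q" and q: "2/3 \<le> q" "q \<le> 1"
    and S: "S \<ge> 200 * ln n"
    and dense: "\<And>i j. i \<in> {1..n} \<Longrightarrow> j \<in> {1..n} \<Longrightarrow> i \<noteq> j \<Longrightarrow> S / 2 < card (edge_nbhd T G \<delta> t i j)"
    and small: "30 * sqrt (ln n / (real L * real n * q * S)) + 16 * (M * \<delta> * n / T) \<le> 1 / (96 * b powr (7/2))"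
  shows "measure_pmf.prob (outcomes_pmf n T L w G)
    {z. \<not> ((\<exists>!\<rho>. stationary_distribution n (P_hat n T L d \<delta> t G z) \<rho>) \<and>
       L2_set (\<lambda>i. pi_hat n T L d \<delta> t G z i - pi_star n w t i) {1..n} / L2_set (pi_star n w t) {1..n}
       \<le> 1536 * (M * \<delta> * n * b powr (7/2) / T) + 64 * b powr (9/2) * sqrt (3 / (real L * real n * q * S)))}
    \<le> 6 / real n ^ 12 + exp (- real n)"
proof -
  define A where "A = {1..n}"
  define \<pi> where "\<pi> = pi_star n w t"
  define r where "r = sqrt b"
  define x where "x = 1 / (L * (S / 2)) * ln n"
  define \<beta> where "\<beta> = M * \<delta> / T"
  have ln: "ln n > 0" using n by simp
  have S0: "S > 0" using S ln by linarith
  have A: "card A = n" "finite A" "1 \<in> A" using n by (auto simp: A_def)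
  have w0: "w t i > 0" if "i \<in> A" for i using w t that by (auto simp: A_def)
  have W: "(\<Sum>k\<in>A. w t k) > 0" using w0 A by (intro sum_pos) auto
  have b: "w t i \<le> b * w t j" if "i \<in> A" "j \<in> A" for i j
    using b_ratio_ge[of i n j w t] that w0[of j] by (simp add: b_def A_def pos_divide_le_eq)
  have b1: "b \<ge> 1" using b_ratio_ge[of 1 n 1 w t] w0[OF A(3)] A by (simp add: b_def A_def)
  have r1: "r \<ge> 1" using b1 by (simp add: r_def)
  have r2: "r\<^sup>2 = b" using b1 by (simp add: r_def)
  have b7: "b powr (7/2) = r ^ 7" and b9: "b powr (9/2) = r ^ 9"
    using powr_half_integer[of b 7] powr_half_integer[of b 9] b1 by (simp_all add: r_def)
  have \<pi>_eq: "\<pi> i = w t i / (\<Sum>k\<in>A. w t k)" for i by (simp add: \<pi>_def pi_star_def A_def)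
  have \<pi>_pos: "\<pi> i > 0" if "i \<in> A" for i using w0[OF that] W by (simp add: \<pi>_eq)
  have \<pi>_sum: "sum \<pi> A = 1" using W by (simp add: \<pi>_eq[abs_def] flip: sum_divide_distrib)
  have \<pi>_ratio: "\<pi> i \<le> r\<^sup>2 * \<pi> j" if "i \<in> A" "j \<in> A" for i j
    using b[OF that] W by (simp add: \<pi>_eq r2 divide_right_mono)
  have y_\<pi>: "y_star w i j t = \<pi> j / (\<pi> i + \<pi> j)" for i j
    using W by (simp add: y_star_def \<pi>_eq flip: add_divide_distrib)
  have \<pi>_le: "\<pi> i \<le> r\<^sup>2 / n" if "i \<in> A" for i
  proof -
    have "(\<Sum>j\<in>A. \<pi> i) \<le> (\<Sum>j\<in>A. r\<^sup>2 * \<pi> j)" using \<pi>_ratio that by (intro sum_mono)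
    hence "n * \<pi> i \<le> r\<^sup>2" using A \<pi>_sum by (simp flip: sum_distrib_left)
    thus ?thesis using n by (simp add: pos_le_divide_eq mult.commute)
  qed
  interpret dense_btl n T L w G \<delta> t "S / 2"
    using L S0 w t dense by unfold_locales (auto intro: less_imp_le)
  have \<beta>0: "\<beta> \<ge> 0" using M \<delta> by (simp add: \<beta>_def)
  have x0: "x \<ge> 0" using ln S0 by (simp add: x_def)
  have d0: "d > 0" "n \<le> d"
  proof -
    have "3 * real n * (2/3) \<le> d" unfolding d using q by (intro mult_left_mono) auto
    thus "d > 0" "n \<le> d" using n by auto
  qed
  have small': "16 * \<beta> * n \<le> 1 / (96 * r ^ 7)" "ln n / (real L * real n * q * S) \<le> (1 / (2880 * r ^ 7))\<^sup>2"
  proof -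
    define u where "u = ln n / (real L * real n * q * S)"
    have u0: "u \<ge> 0" using ln S0 q by (simp add: u_def)
    have "30 * sqrt u + 16 * \<beta> * n \<le> 1 / (96 * r ^ 7)"
      using small by (simp add: u_def \<beta>_def b7 mult_ac)
    moreover have "0 \<le> 16 * \<beta> * n" using \<beta>0 by simp
    moreover have "0 \<le> sqrt u" using u0 by simp
    ultimately have "16 * \<beta> * n \<le> 1 / (96 * r ^ 7)" "30 * sqrt u \<le> 1 / (96 * r ^ 7)" by linarith+
    thus "16 * \<beta> * n \<le> 1 / (96 * r ^ 7)" by simp
    have "sqrt u \<le> 1 / (2880 * r ^ 7)" using \<open>30 * sqrt u \<le> _\<close> by simp
    hence "(sqrt u)\<^sup>2 \<le> (1 / (2880 * r ^ 7))\<^sup>2" using u0 by (intro power_mono) auto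
    thus "ln n / (real L * real n * q * S) \<le> (1 / (2880 * r ^ 7))\<^sup>2" using u0 by (simp add: u_def)
  qed
  \<comment> \<open>From \<open>30 * sqrt u \<le> 1 / (96 * r^7)\<close> with
    \<open>2880 = 30 * 96\<close>, and \<open>x = 2 * n * q * u\<close>; the constant is
    \<open>2880^2 / 2\<close>.\<close>
  have x_r: "x * r ^ 14 \<le> n / 4147200"
  proof -
    have "x = n * (2 * q * (ln n / (real L * real n * q * S)))"
      using n q S0 L by (simp add: x_def field_simps)
    also have "\<dots> \<le> n * (2 * 1 * (1 / (2880 * r ^ 7))\<^sup>2)"
      using small'(2) q ln S0 by (intro mult_left_mono mult_mono) auto
    also have "\<dots> = n / 4147200 / r ^ 14"
      by (simp add: power_divide power_mult_distrib flip: power_mult)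
    finally show ?thesis using r1 by (simp add: pos_le_divide_eq)
  qed
  \<comment> \<open>Here \<open>x = 2 * ln n / (L * S)\<close>, so \<open>S \<ge> 200 * ln n\<close>
    is what is used.\<close>
  have x_small: "x \<le> 1 / 100"
  proof -
    have "2 * ln n \<le> S / 100" using S by simp
    also have "\<dots> \<le> L * S / 100" using L S0 by simp
    finally show ?thesis using L S0 by (simp add: x_def field_simps)
  qed
  have r_le: "r ^ k \<le> r ^ 14" if "k \<le> 14" for k using r1 that by (rule power_increasing[rotated])
  have h1: "1792 * x * r ^ 4 \<le> n"
  proof -
    have "x * r ^ 4 \<le> x * r ^ 14" using r_le[of 4] x0 by (intro mult_left_mono) auto
    thus ?thesis using x_r by linarith
  qed
  \<comment> \<open>The square is split as \<open>x\<close> times \<open>x * r^12\<close>: the first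
    factor is bounded by \<open>x_small\<close>, the second absorbs all powers of \<open>r\<close>
    through \<open>x_r\<close>.\<close>
  have h2: "3584 * x * r ^ 6 \<le> sqrt n"
  proof (rule real_le_rsqrt)
    have "(3584 * x * r ^ 6)\<^sup>2 = 12845056 * (x * (x * r ^ 12))"
      by (simp add: power_mult_distrib power2_eq_square[of x] flip: power_mult)
    also have "x * (x * r ^ 12) \<le> 1 / 100 * (n / 4147200)"
    proof (intro mult_mono x_small)
      have "x * r ^ 12 \<le> x * r ^ 14" using r_le[of 12] x0 by (intro mult_left_mono) auto
      thus "x * r ^ 12 \<le> n / 4147200" using x_r by linarith
    qed (use x0 r1 in auto)
    finally show "(3584 * x * r ^ 6)\<^sup>2 \<le> n" by simp
  qed
  have h3: "16 * r ^ 3 * \<beta> \<le> 1"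
  proof -
    have "16 * r ^ 3 * \<beta> = r ^ 3 * (16 * \<beta> * 1)" by simp
    also have "\<dots> \<le> r ^ 7 * (16 * \<beta> * n)"
      using r1 n \<beta>0 by (intro mult_mono power_increasing) auto
    also have "\<dots> \<le> r ^ 7 * (1 / (96 * r ^ 7))" using small'(1) r1 by (intro mult_left_mono) auto
    also have "\<dots> \<le> 1" using r1 by simp
    finally show ?thesis .
  qed
  define Good where "Good z \<longleftrightarrow> (\<forall>i\<in>A. (\<Sum>k\<in>A. X z i k)\<^sup>2 \<le> 7 * x * n) \<and>
           (\<forall>i\<in>A. (\<Sum>k\<in>A. \<bar>\<Sum>j\<in>A. X z i j * X z k j\<bar>) \<le> 14 * x * n * sqrt n) \<and>
           (\<Sum>j\<in>A. (\<Sum>k\<in>A. (\<pi> j + \<pi> k) * X z j k)\<^sup>2) \<le> 4 * n\<^sup>2 * (1 / (L * (S / 2))) * (2 * r\<^sup>2 / n)\<^sup>2" for z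
  have prob: "measure_pmf.prob coins {z. \<not> Good z} \<le> 6 / real n ^ 12 + exp (- real n)"
    unfolding Good_def x_def A_def
  proof (rule typical_matrix)
    \<comment> \<open>The weights of the noise in the drift of \<pi>: no entry of \<pi> exceeds
      \<open>r^2 / n\<close>, by comparison with the average \<open>1/n\<close>.\<close>
    show "\<bar>\<pi> i + \<pi> j\<bar> \<le> 2 * r\<^sup>2 / n" if "i \<in> {1..n}" "j \<in> {1..n}" for i j
      using \<pi>_le[of i] \<pi>_le[of j] \<pi>_pos[of i] \<pi>_pos[of j] that by (simp add: A_def)
  qed (use n r1 in \<open>auto simp: add.commute\<close>)
  have bound: "(\<exists>!\<rho>. stationary_distribution n (P_hat n T L d \<delta> t G z) \<rho>) \<and>
       L2_set (\<lambda>i. pi_hat n T L d \<delta> t G z i - \<pi> i) A / L2_set \<pi> A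
       \<le> 1536 * (M * \<delta> * n * b powr (7/2) / T) + 64 * b powr (9/2) * sqrt (3 / (real L * real n * q * S))"
    if z: "Good z" for z
  proof -
    have "\<exists>\<rho>. stationary_distribution n (P_hat n T L d \<delta> t G z) \<rho> \<and>
       (\<forall>\<rho>'. stationary_distribution n (P_hat n T L d \<delta> t G z) \<rho>' \<longrightarrow> \<rho>' = \<rho>) \<and>
       L2_set (\<lambda>i. \<rho> i - \<pi> i) {1..n} / L2_set \<pi> {1..n} \<le> 16 * r ^ 5 * sqrt (1 / (L * (S / 2)) / n) + 8 * r ^ 3 * \<beta>"
    proof (rule stationary_distribution_perturbation)
      show "P_hat n T L d \<delta> t G z i k = (\<pi> k / (\<pi> i + \<pi> k) + (X z i k + bias T w G \<delta> t i k)) / d"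
        if "i \<in> {1..n}" "k \<in> {1..n}" "i \<noteq> k" for i k
        using P_hat_off_eq[OF that] that by (simp add: P_hat_def y_\<pi>)
      show "stochastic_matrix n (P_hat n T L d \<delta> t G z)" by (rule stochastic_P_hat[OF d0])
      show "\<bar>bias T w G \<delta> t i k\<bar> \<le> \<beta>" if "i \<in> {1..n}" "k \<in> {1..n}" for i k
        unfolding \<beta>_def by (rule bias_bound[OF that M \<delta>]) (use smooth t that in blast)
      show "X z i k = - X z k i" for i k by (rule X_antisym)
      show "bias T w G \<delta> t i k = - bias T w G \<delta> t k i" if "i \<in> {1..n}" "k \<in> {1..n}" for i k
        using that by (rule bias_antisym)
      show "(\<Sum>j\<in>{1..n}. (\<Sum>k\<in>{1..n}. (\<pi> j + \<pi> k) * X z j k)\<^sup>2)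
          \<le> 4 * n\<^sup>2 * (1 / (L * (S / 2))) * (2 * r\<^sup>2 / n)\<^sup>2"
        using z unfolding Good_def A_def by blast
      show "(\<Sum>k\<in>{1..n}. X z i k)\<^sup>2 \<le> 7 * x * n" if "i \<in> {1..n}" for i
        using z that unfolding Good_def A_def by blast
      show "(\<Sum>k\<in>{1..n}. \<bar>\<Sum>j\<in>{1..n}. X z i j * X z k j\<bar>) \<le> 14 * x * n * sqrt n" if "i \<in> {1..n}" for i
        using z that unfolding Good_def A_def by blast
    qed (use n in \<open>simp_all only: r1 d0 x0 h1 h2 h3 \<beta>0 \<pi>_sum[unfolded A_def] \<pi>_pos[unfolded A_def] \<pi>_ratio[unfolded A_def]\<close>)
    then obtain \<rho> where \<rho>: "stationary_distribution n (P_hat n T L d \<delta> t G z) \<rho>"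
      "\<forall>\<rho>'. stationary_distribution n (P_hat n T L d \<delta> t G z) \<rho>' \<longrightarrow> \<rho>' = \<rho>"
      "L2_set (\<lambda>i. \<rho> i - \<pi> i) {1..n} / L2_set \<pi> {1..n} \<le> 16 * r ^ 5 * sqrt (1 / (L * (S / 2)) / n) + 8 * r ^ 3 * \<beta>"
      by (elim exE conjE)
    have pi_hat: "pi_hat n T L d \<delta> t G z = \<rho>"
      unfolding pi_hat_def using \<rho>(1) \<rho>(2)[rule_format] by (rule the_equality)
    have unique: "\<exists>!\<rho>. stationary_distribution n (P_hat n T L d \<delta> t G z) \<rho>"
      using \<rho>(1) \<rho>(2)[rule_format] by (rule ex1I)
    \<comment> \<open>The left root is that of \<open>2 / (L * n * S)\<close>; q \<le> 1 and r \<ge>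
      1 bring it to the shape of the claimed rate.\<close>
    have "16 * r ^ 5 * sqrt (1 / (L * (S / 2)) / n) \<le> 64 * r ^ 9 * sqrt (3 / (real L * real n * q * S))"
    proof (intro mult_mono real_sqrt_le_mono power_increasing)
      have "1 / (L * (S / 2)) / n = 2 / (real L * real n * S)" using L n S0 by (simp add: field_simps)
      also have "\<dots> \<le> 3 / (real L * real n * S * q)"
        using L n S0 q by (intro frac_le) (auto simp: mult_le_cancel_left1)
      finally show "1 / (L * (S / 2)) / n \<le> 3 / (real L * real n * q * S)" by (simp add: mult_ac)
    qed (use r1 S0 in auto)
    moreover have "8 * r ^ 3 * \<beta> \<le> 1536 * (M * \<delta> * n * r ^ 7 / T)"
    proof -
      have "8 * r ^ 3 * (1 * \<beta>) \<le> 1536 * r ^ 7 * (n * \<beta>)"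
        using r1 n \<beta>0 by (intro mult_mono power_increasing) auto
      thus ?thesis by (simp add: \<beta>_def mult_ac)
    qed
    ultimately show ?thesis using \<rho>(3) unique unfolding pi_hat b7 b9 A_def by linarith
  qed
  have "measure_pmf.prob (outcomes_pmf n T L w G)
    {z. \<not> ((\<exists>!\<rho>. stationary_distribution n (P_hat n T L d \<delta> t G z) \<rho>) \<and>
       L2_set (\<lambda>i. pi_hat n T L d \<delta> t G z i - pi_star n w t i) {1..n} / L2_set (pi_star n w t) {1..n}
       \<le> 1536 * (M * \<delta> * n * b powr (7/2) / T) + 64 * b powr (9/2) * sqrt (3 / (real L * real n * q * S)))}
    \<le> measure_pmf.prob coins {z. \<not> Good z}"
    unfolding outcomes_eq_coins using bound[unfolded A_def \<pi>_def]
    by (intro measure_pmf.finite_measure_mono subsetI) (blast, simp)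
  thus ?thesis using prob by linarith
qed

theorem theorem2:
  "\<exists>c1 c0 c2 C1 C2 K :: real.
     c1 > 0 \<and> c0 \<ge> 1 \<and> c2 \<ge> 1 \<and> C1 \<ge> 15 \<and> C2 \<ge> 1 \<and> K \<ge> 0 \<and>
     (\<forall>(n::nat) (T::nat) (L::nat) (M::real) (w::real \<Rightarrow> nat \<Rightarrow> real) (p::real \<Rightarrow> real)
        (\<delta>::real) (t::real) (d::real).
        n \<ge> 2 \<longrightarrow> T \<ge> 1 \<longrightarrow> L \<ge> 1 \<longrightarrow> M \<ge> 0 \<longrightarrow>
        (\<forall>s\<in>{0..1}. \<forall>i\<in>{1..n}. w s i > 0) \<longrightarrow>
        (\<forall>s\<in>{0..1}. \<forall>s'\<in>{0..1}. \<forall>i\<in>{1..n}. \<forall>j\<in>{1..n}. i \<noteq> j \<longrightarrow>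
           \<bar>y_star w i j s - y_star w i j s'\<bar> \<le> M * \<bar>s - s'\<bar>) \<longrightarrow>
        (\<forall>t'\<in>grid T. 0 \<le> p t' \<and> p t' \<le> 1) \<longrightarrow>
        t \<in> {0..1} \<longrightarrow> \<delta> \<in> {1/2..real T} \<longrightarrow>
        d = 3 * real n * p_union T p \<delta> t \<longrightarrow>
        real n \<ge> c1 * ln (real n) \<longrightarrow>
        real n * p_union T p \<delta> t \<ge> c0 * ln (real n) \<longrightarrow>
        p_sum T p \<delta> t \<ge> c2 * ln (real n) \<longrightarrow>
        2 * C1 * sqrt (ln (real n) / (real L * real n * p_union T p \<delta> t * p_sum T p \<delta> t))
          + 16 * (M * \<delta> * real n / real T)
          \<le> 1 / (96 * b_ratio n w t powr (7/2)) \<longrightarrow>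
        measure_pmf.prob (dynamic_btl_pmf n T L w p)
          {(G, z).
             (\<exists>!\<pi>. stationary_distribution n (P_hat n T L d \<delta> t G z) \<pi>) \<and>
             L2_set (\<lambda>i. pi_hat n T L d \<delta> t G z i - pi_star n w t i) {1..n}
               / L2_set (pi_star n w t) {1..n}
             \<le> 1536 * (M * \<delta> * real n * b_ratio n w t powr (7/2) / real T)
               + 64 * C2 * b_ratio n w t powr (9/2)
                 * sqrt (3 / (real L * real n * p_union T p \<delta> t * p_sum T p \<delta> t))}
          \<ge> 1 - K / real n ^ 10)"
\<comment> \<open>\<open>c1 = 10\<close> turns \<open>exp (- n)\<close> into at most
  \<open>n^-10\<close>. \<open>c2 = 200\<close> yields \<open>x \<le> 1/100\<close>, a union
  probability of at least 2/3, and failure at most \<open>n^-20\<close> for a single pair.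
  \<open>C1 = 15\<close> is the factor 30 of the conditional bound. \<open>K = 8\<close> adds 1 for
  the graphs and 7 for the coins.\<close>
proof (rule exI[of _ 10], rule exI[of _ 1], rule exI[of _ 200], rule exI[of _ 15], rule exI[of _ 1],
    rule exI[of _ 8], intro conjI allI impI)
  fix n T L :: nat and M :: real and w :: "real \<Rightarrow> nat \<Rightarrow> real" and p :: "real \<Rightarrow> real" and \<delta> t d :: real
  define q where "q = p_union T p \<delta> t"
  define S where "S = p_sum T p \<delta> t"
  define b where "b = b_ratio n w t"
  assume n: "2 \<le> n" and L: "1 \<le> L" and M: "0 \<le> M"
    and w: "\<forall>s\<in>{0..1}. \<forall>i\<in>{1..n}. 0 < w s i"
    and smooth: "\<forall>s\<in>{0..1}. \<forall>s'\<in>{0..1}. \<forall>i\<in>{1..n}. \<forall>j\<in>{1..n}. i \<noteq> j \<longrightarrow>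
           \<bar>y_star w i j s - y_star w i j s'\<bar> \<le> M * \<bar>s - s'\<bar>"
    and p: "\<forall>t'\<in>grid T. 0 \<le> p t' \<and> p t' \<le> 1"
    and t: "t \<in> {0..1}" and \<delta>: "\<delta> \<in> {1/2..real T}" and d: "d = 3 * real n * p_union T p \<delta> t"
    and n_ln: "10 * ln (real n) \<le> real n"
    and S_ln: "200 * ln (real n) \<le> p_sum T p \<delta> t"
    and small: "2 * 15 * sqrt (ln (real n) / (real L * real n * p_union T p \<delta> t * p_sum T p \<delta> t))
          + 16 * (M * \<delta> * real n / real T) \<le> 1 / (96 * b_ratio n w t powr (7/2))"
  define Q where "Q G z \<longleftrightarrow> (\<exists>!\<pi>. stationary_distribution n (P_hat n T L d \<delta> t G z) \<pi>) \<and>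
             L2_set (\<lambda>i. pi_hat n T L d \<delta> t G z i - pi_star n w t i) {1..n}
               / L2_set (pi_star n w t) {1..n}
             \<le> 1536 * (M * \<delta> * real n * b powr (7/2) / real T)
               + 64 * b powr (9/2) * sqrt (3 / (real L * real n * q * S))" for G z
  define pairs where "pairs = {(i, j) \<in> {1..n} \<times> {1..n}. i \<noteq> j}"
  define Bad where "Bad = (\<Union>(i, j)\<in>pairs. {G. real (card (edge_nbhd T G \<delta> t i j)) \<le> S / 2})"
  have ln: "ln n \<ge> 2/3"
    using n ln2_ge_two_thirds ln_le_cancel_iff[of 2 "real n"] by linarith
  have S100: "S \<ge> 100" using S_ln ln by (simp add: S_def)
  \<comment> \<open>The lower bound makes \<open>d = 3 * n * q\<close> at least
    \<open>2 * n\<close>, which the stochasticity of the estimated matrix rests on.\<close>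
  have q: "2/3 \<le> q" "q \<le> 1"
  proof -
    have "exp (- S) \<le> 1 / (1 + S)"
      using exp_ge_add_one_self[of S] S100 by (simp add: exp_minus field_simps)
    also have "\<dots> \<le> 1/3" using S100 by (simp add: field_simps)
    finally show "2/3 \<le> q" "q \<le> 1" using p_union_bounds[of T p \<delta> t] p by (auto simp: q_def S_def)
  qed
  have exp_n: "exp (- (real k * ln n)) = 1 / real n ^ k" for k
    using n by (simp add: exp_minus exp_of_nat_mult inverse_eq_divide)
  have "measure_pmf.prob (graphs_pmf n T p) Bad \<le> 1 / real n ^ 10"
  proof -
    have "finite pairs" "card pairs \<le> n\<^sup>2"
    proof -
      have "pairs \<subseteq> {1..n} \<times> {1..n}" by (auto simp: pairs_def)
      thus "finite pairs" "card pairs \<le> n\<^sup>2"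
        using card_mono[of "{1..n} \<times> {1..n}" pairs]
        by (auto simp: card_cartesian_product power2_eq_square intro: finite_subset)
    qed
    have "measure_pmf.prob (graphs_pmf n T p) Bad \<le>
        (\<Sum>u\<in>pairs. measure_pmf.prob (graphs_pmf n T p)
          (case u of (i, j) \<Rightarrow> {G. real (card (edge_nbhd T G \<delta> t i j)) \<le> S / 2}))"
      unfolding Bad_def by (rule measure_UNION_le) (use \<open>finite pairs\<close> in auto)
    also have "\<dots> \<le> (\<Sum>u\<in>pairs. 1 / real n ^ 12)"
    proof (intro sum_mono)
      fix u assume "u \<in> pairs"
      then obtain i j where u: "u = (i, j)" "i \<in> {1..n}" "j \<in> {1..n}" "i \<noteq> j" by (auto simp: pairs_def)
      have "measure_pmf.prob (graphs_pmf n T p) {G. real (card (edge_nbhd T G \<delta> t i j)) \<le> S / 2} \<le> exp (- S / 10)"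
        unfolding S_def by (rule few_edges_tail) (use u p in auto)
      \<comment> \<open>The exponent 12 leaves \<open>n^-10\<close> after the union bound over at
        most \<open>n^2\<close> pairs.\<close>
      also have "\<dots> \<le> exp (- (real 12 * ln n))" using S_ln ln by (simp add: S_def)
      also have "\<dots> = 1 / real n ^ 12" by (rule exp_n)
      finally show "measure_pmf.prob (graphs_pmf n T p)
          (case u of (i, j) \<Rightarrow> {G. real (card (edge_nbhd T G \<delta> t i j)) \<le> S / 2}) \<le> 1 / real n ^ 12" by (simp add: u)
    qed
    also have "\<dots> \<le> real (n\<^sup>2) * (1 / real n ^ 12)"
      using \<open>card pairs \<le> n\<^sup>2\<close> by (simp add: divide_right_mono del: of_nat_power)
    also have "\<dots> = 1 / real n ^ 10"
      using n power_add[of "real n" 2 10] by (simp add: field_simps)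
    finally show ?thesis .
  qed
  moreover have tail: "6 / real n ^ 12 + exp (- real n) \<le> 7 / real n ^ 10"
  proof -
    have "6 / real n ^ 12 \<le> 6 / real n ^ 10"
      using n by (intro divide_left_mono power_increasing) auto
    moreover have "exp (- real n) \<le> 1 / real n ^ 10"
      unfolding exp_n[symmetric] using n_ln by simp
    ultimately show ?thesis by simp
  qed
  \<comment> \<open>The two sources of failure are added: some pair is compared too rarely, or the
    coins are atypical although every pair is compared often.\<close>
  moreover have "measure_pmf.prob (dynamic_btl_pmf n T L w p) {(G, z). \<not> Q G z} \<le>
      measure_pmf.prob (graphs_pmf n T p) Bad + (6 / real n ^ 12 + exp (- real n))"
    unfolding dynamic_btl_pmf_def
  proof (rule prob_bind_pmf_le)
    fix G assume G: "G \<notin> Bad"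
    have dense: "S / 2 < card (edge_nbhd T G \<delta> t i j)" if "i \<in> {1..n}" "j \<in> {1..n}" "i \<noteq> j" for i j
    proof -
      have "(i, j) \<in> pairs" using that by (simp add: pairs_def)
      hence "G \<notin> {G. real (card (edge_nbhd T G \<delta> t i j)) \<le> S / 2}" using G unfolding Bad_def by blast
      thus ?thesis by simp
    qed
    have "measure_pmf.prob (map_pmf (Pair G) (outcomes_pmf n T L w G)) {(G, z). \<not> Q G z} =
        measure_pmf.prob (outcomes_pmf n T L w G) {z. \<not> Q G z}"
      by (simp add: vimage_def)
    also have "\<dots> \<le> 6 / real n ^ 12 + exp (- real n)"
      unfolding Q_def b_def
    proof (rule conditional_error_bound[OF n L M w smooth t _ _ q])
      show "S / 2 < card (edge_nbhd T G \<delta> t i j)" if "i \<in> {1..n}" "j \<in> {1..n}" "i \<noteq> j" for i j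
        using that by (rule dense)
    qed (use \<delta> d S_ln small in \<open>simp_all add: S_def q_def\<close>)
    finally show "measure_pmf.prob (map_pmf (Pair G) (outcomes_pmf n T L w G)) {(G, z). \<not> Q G z}
        \<le> 6 / real n ^ 12 + exp (- real n)" .
  qed simp
  ultimately have "measure_pmf.prob (dynamic_btl_pmf n T L w p) {(G, z). \<not> Q G z} \<le> 8 / real n ^ 10"
    by simp
  moreover have "measure_pmf.prob (dynamic_btl_pmf n T L w p) {(G, z). Q G z} =
      1 - measure_pmf.prob (dynamic_btl_pmf n T L w p) {(G, z). \<not> Q G z}"
  proof -
    have eq: "{(G, z). \<not> Q G z} = space (measure_pmf (dynamic_btl_pmf n T L w p)) - {(G, z). Q G z}"
      by auto
    show ?thesis
      unfolding eq by (subst measure_pmf.prob_compl) simp_all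
  qed
  ultimately have "1 - 8 / real n ^ 10 \<le> measure_pmf.prob (dynamic_btl_pmf n T L w p) {(G, z). Q G z}"
    by linarith
  thus "1 - 8 / real n ^ 10 \<le> measure_pmf.prob (dynamic_btl_pmf n T L w p)
          {(G, z).
             (\<exists>!\<pi>. stationary_distribution n (P_hat n T L d \<delta> t G z) \<pi>) \<and>
             L2_set (\<lambda>i. pi_hat n T L d \<delta> t G z i - pi_star n w t i) {1..n}
               / L2_set (pi_star n w t) {1..n}
             \<le> 1536 * (M * \<delta> * real n * b_ratio n w t powr (7/2) / real T)
               + 64 * 1 * b_ratio n w t powr (9/2)
                 * sqrt (3 / (real L * real n * p_union T p \<delta> t * p_sum T p \<delta> t))}"
    by (simp only: Q_def b_def q_def S_def mult_1_right)
qed simp_all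

end
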